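(* Let $\mu\in V_n$ be an arbitrary algebra on $\mathbb C^n$. Then (1) $\mu$ admits a Nikolayevsky derivation $\phi_\mu$; (2) $\phi_\mu$ is unique up to automorphisms of $\mu$ (i.e. any two Nikolayevsky derivations are conjugate by an automorphism of $\mu$); (3) all eigenvalues of $\phi_\mu$ are rational numbers. Moreover, if $[\mu]$ is a critical point of $F_n:\mathbb PV_n\to\mathbb R$ with $\mathrm M_\mu=c_\mu I+D_\mu$, $c_\mu\in\mathbb R$, $D_\mu\in\mathrm{Der}(\mu)$, then $-\frac1{c_\mu}D_\mu$ is a Nikolayevsky derivation of $\mu$.
   Context: $V_n$ is the space of bilinear maps $\mu:\mathbb C^n\times\mathbb C^n\to\mathbb C^n$ (arbitrary complex algebras). $\mathrm{Der}(\mu)$ is its derivation algebra. A Nikolayevsky derivation of $\mu$ is a derivation $\phi\in\mathrm{Der}(\mu)$ which is semisimple (diagonalizable) with all eigenvalues real and satisfies $\operatorname{tr}(\phi\psi)=\operatorname{tr}\psi$ for all $\psi\in\mathrm{Der}(\mu)$. With the standard Hermitian inner product on $\mathbb C^n$, $L^\mu_XY=\mu(X,Y)$, $R^\mu_XY=\mu(Y,X)$, $\mathrm M_\mu=2\sum_i L^\mu_{X_i}(L^\mu_{X_i})^*-2\sum_i (L^\mu_{X_i})^*L^\mu_{X_i}-2\sum_i (R^\mu_{X_i})^*R^\mu_{X_i}$ for an orthonormal basis $\{X_i\}$, and $F_n([\mu])=\operatorname{tr}\mathrm M_\mu^2/\|\mu\|^4$ with $\|\mu\|^2=\sum_{i,j}\|\mu(X_i,X_j)\|^2$.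 $[\mu]$ is a critical point of $F_n$ iff $\mathrm M_\mu=c_\mu I+D_\mu$ with $c_\mu\in\mathbb R$, $D_\mu\in\mathrm{Der}(\mu)$. *)

theory Defs
  imports "HOL-Analysis.Analysis"
begin

text \<open>An algebra on C^n: a complex-bilinear map mu : C^n x C^n -> C^n.
  C^n is modelled as complex^'n for an arbitrary finite index type 'n.
  Linear maps of C^n are n x n complex matrices acting by *v.\<close>

definition cbilinear :: "(complex^'n \<Rightarrow> complex^'n \<Rightarrow> complex^'n) \<Rightarrow> bool" where
  "cbilinear mu \<longleftrightarrow>
     (\<forall>x y z. mu (x + y) z = mu x z + mu y z) \<and>
     (\<forall>x y z. mu x (y + z) = mu x y + mu x z) \<and>
     (\<forall>(c::complex) x y. mu (c *s x) y = c *s mu x y) \<and>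
     (\<forall>(c::complex) x y. mu x (c *s y) = c *s mu x y)"

definition is_derivation :: "(complex^'n \<Rightarrow> complex^'n \<Rightarrow> complex^'n) \<Rightarrow> complex^'n^'n \<Rightarrow> bool" where
  "is_derivation mu D \<longleftrightarrow> (\<forall>x y. D *v mu x y = mu (D *v x) y + mu x (D *v y))"

definition is_automorphism :: "(complex^'n \<Rightarrow> complex^'n \<Rightarrow> complex^'n) \<Rightarrow> complex^'n^'n \<Rightarrow> bool" where
  "is_automorphism mu g \<longleftrightarrow> invertible g \<and> (\<forall>x y. g *v mu x y = mu (g *v x) (g *v y))"

definition real_diagonalizable :: "complex^'n^'n \<Rightarrow> bool" where
  "real_diagonalizable A \<longleftrightarrow>
     (\<exists>P (d::'n \<Rightarrow> real). invertible P \<and>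
        A = P ** (\<chi> i j. if i = j then complex_of_real (d i) else 0) ** matrix_inv P)"

definition nikolayevsky_derivation :: "(complex^'n \<Rightarrow> complex^'n \<Rightarrow> complex^'n) \<Rightarrow> complex^'n^'n \<Rightarrow> bool" where
  "nikolayevsky_derivation mu phi \<longleftrightarrow>
     is_derivation mu phi \<and> real_diagonalizable phi \<and>
     (\<forall>psi. is_derivation mu psi \<longrightarrow> trace (phi ** psi) = trace psi)"

definition is_eigenvalue :: "complex^'n^'n \<Rightarrow> complex \<Rightarrow> bool" where
  "is_eigenvalue A l \<longleftrightarrow> (\<exists>v. v \<noteq> 0 \<and> A *v v = l *s v)"

definition adjoint_mat :: "complex^'n^'n \<Rightarrow> complex^'n^'n" where
  "adjoint_mat A = (\<chi> i j. cnj (A $ j $ i))"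

definition Lmat :: "(complex^'n \<Rightarrow> complex^'n \<Rightarrow> complex^'n) \<Rightarrow> complex^'n \<Rightarrow> complex^'n^'n" where
  "Lmat mu X = (\<chi> k j. mu X (axis j 1) $ k)"

definition Rmat :: "(complex^'n \<Rightarrow> complex^'n \<Rightarrow> complex^'n) \<Rightarrow> complex^'n \<Rightarrow> complex^'n^'n" where
  "Rmat mu X = (\<chi> k j. mu (axis j 1) X $ k)"

definition M_mat :: "(complex^'n \<Rightarrow> complex^'n \<Rightarrow> complex^'n) \<Rightarrow> complex^'n^'n" where
  "M_mat mu =
     2 *\<^sub>R (\<Sum>i\<in>UNIV. Lmat mu (axis i 1) ** adjoint_mat (Lmat mu (axis i 1)))
   - 2 *\<^sub>R (\<Sum>i\<in>UNIV. adjoint_mat (Lmat mu (axis i 1)) ** Lmat mu (axis i 1))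
   - 2 *\<^sub>R (\<Sum>i\<in>UNIV. adjoint_mat (Rmat mu (axis i 1)) ** Rmat mu (axis i 1))"

end

theory Submission
  imports "Jordan_Normal_Form.Jordan_Normal_Form_Existence" Defs
begin

text \<open>The radical N of the trace form tr(AB) on Der(mu) is an ideal. If A is a derivation with
  generalized eigenvalues d i and f is additive, then the semisimple map with eigenvalues f (d i) is
  again a derivation. With f = cnj this makes every element of N nilpotent, so N satisfies Engel's
  theorem and the trace vanishes on N; hence the trace is represented by some A in Der(mu), and its
  semisimple part represents it as well. Applying rational functionals f with f 1 = 0 shows that
  the eigenvalues of a semisimple representative are rational. Two representatives differ by an
  element of N, which conjugation by exponentials of elements of N removes step by step.
  For critical points, tr(M A) = 0 for derivations A because M is the moment map, and M is
  Hermitian.\<close>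

section \<open>Jordan decomposition\<close>

hide_const (open) VectorSpace.subspace
no_notation vec_index (infixl \<open>$\<close> 100)
no_notation transpose_mat (\<open>(_\<^sup>T)\<close> [1000])

text \<open>The Leibniz rule sees eigenvalues only through sums, since generalized eigenspaces
  multiply by adding eigenvalues. Hence additivity of \<open>f\<close> is enough for replicas, and
  conjugation or a rational-linear functional is allowed. This takes the place of a Levi and torus
  decomposition of Der(mu). Nilpotency of single elements of N already gives trace 0. Engel's
  theorem supplies more, one flag common to all of N: it controls products with derivations that
  normalize N, and it measures the corrections in the conjugacy argument, which stop because the
  flag terminates. The obstacle for the semisimple part S of A is that the nilpotent part must pair
  to 0 also with derivations that do not commute with S. Splitting along ad S reduces this to
  commuting ones, and the same splitting yields the elements that are exponentiated for conjugacy.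
  Subspaces, spans and dimensions are real throughout; complex statements follow because Der(mu) is
  closed under multiplication by i.\<close>

lemma matrix_entry_eqI: "(\<And>i j. A $ i $ j = B $ i $ j) \<Longrightarrow> A = B"
  by (simp add: vec_eq_iff)

lemma matrix_inv_inverse:
  fixes P :: "complex^'n^'n"
  assumes "invertible P"
  shows matrix_inv_right: "P ** matrix_inv P = mat 1" and matrix_inv_left: "matrix_inv P ** P = mat 1"
proof -
  have "P ** matrix_inv P = mat 1 \<and> matrix_inv P ** P = mat 1"
    using assms unfolding invertible_def matrix_inv_def by (rule someI_ex)
  then show "P ** matrix_inv P = mat 1" "matrix_inv P ** P = mat 1" by simp_all
qed

lemma matrix_inv_eqI:
  fixes P :: "complex^'n^'n"
  assumes "P ** Q = mat 1" "Q ** P = mat 1"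
  shows "matrix_inv P = Q"
proof -
  have "invertible P" using assms unfolding invertible_def by blast
  then have "matrix_inv P ** (P ** Q) = Q"
    by (simp add: matrix_mul_assoc matrix_inv_left)
  then show ?thesis using assms by simp
qed

text \<open>A nonzero entry is on the diagonal or is a 1 just above it inside one block. Only these
  consequences of the Jordan form are used.\<close>

lemma jordan_matrix_entry:
  assumes "i < sum_list (map fst n_as)" "j < sum_list (map fst n_as)"
    and "jordan_matrix n_as $$ (i, j) \<noteq> (0 :: 'a :: zero_neq_one)"
  shows "jordan_matrix n_as $$ (i, i) = jordan_matrix n_as $$ (j, j) \<and> i \<le> j"
  using assms
proof (induction n_as arbitrary: i j)
  case Nil
  then show ?case by simp
next
  case (Cons na n_as)
  obtain n a where na: "na = (n, a)" by force
  let ?J = "jordan_matrix n_as" and ?m = "sum_list (map fst n_as)"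
  have entry: "jordan_matrix (na # n_as) $$ (k, l) =
      (if k < n then if l < n then jordan_block n a $$ (k, l) else 0
       else if l < n then 0 else ?J $$ (k - n, l - n))"
    if "k < n + ?m" "l < n + ?m" for k l
    using that jordan_matrix_dim[of n_as] unfolding jordan_matrix_def na by (auto simp: Let_def)
  have ij: "i < n + ?m" "j < n + ?m" and nz: "jordan_matrix (na # n_as) $$ (i, j) \<noteq> 0"
    using Cons.prems by (simp_all add: na)
  show ?case
  proof (cases "i < n \<and> j < n")
    case True
    then show ?thesis
      using nz unfolding entry[OF ij] entry[OF ij(1) ij(1)] entry[OF ij(2) ij(2)]
      by (auto split: if_splits)
  next
    case False
    then have ge: "\<not> i < n" "\<not> j < n" and "?J $$ (i - n, j - n) \<noteq> 0"
      using nz unfolding entry[OF ij] by (auto split: if_splits)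
    moreover from ge ij have "i - n < ?m" "j - n < ?m" by linarith+
    ultimately have "?J $$ (i - n, i - n) = ?J $$ (j - n, j - n)" "i - n \<le> j - n"
      using Cons.IH by blast+
    moreover from this ge have "i \<le> j" by linarith
    ultimately show ?thesis
      using ge unfolding entry[OF ij(1) ij(1)] entry[OF ij(2) ij(2)] by auto
  qed
qed

text \<open>\<open>B\<close> is \<open>diag d\<close> plus a strictly triangular matrix commuting
  with \<open>diag d\<close>. The index type carries no order, so the injective rank
  \<open>r\<close> supplies one. Unlike the Jordan form, the condition survives subtracting
  \<open>diag d\<close>, with weights 0.\<close>

definition block_triangular :: "complex^'n^'n \<Rightarrow> ('n \<Rightarrow> complex) \<Rightarrow> ('n \<Rightarrow> nat) \<Rightarrow> bool" where
  "block_triangular B d r \<longleftrightarrow> inj r \<and> (\<forall>i. B $ i $ i = d i) \<and>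
     (\<forall>i j. B $ i $ j \<noteq> 0 \<longrightarrow> d i = d j \<and> r i \<le> r j)"

lemma jordan_decomposition:
  fixes A :: "complex^'n^'n"
  obtains P B :: "complex^'n^'n" and d :: "'n \<Rightarrow> complex" and r :: "'n \<Rightarrow> nat"
  where "invertible P" "A = P ** B ** matrix_inv P" "block_triangular B d r"
proof -
  let ?n = "CARD('n)"
  obtain h where h: "bij_betw h {0..<?n} (UNIV :: 'n set)"
    using ex_bij_betw_nat_finite[of "UNIV :: 'n set"] by auto
  define r where "r = inv_into {0..<?n} h"
  have r: "bij_betw r UNIV {0..<?n}" unfolding r_def by (rule bij_betw_inv_into[OF h])
  have rh: "r (h i) = i" if "i < ?n" for i
    using that h unfolding r_def by (simp add: bij_betw_inv_into_left)
  have hr: "h (r x) = x" for x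
    using h unfolding r_def by (simp add: bij_betw_inv_into_right)
  have rn: "r x < ?n" for x using r by (auto dest: bij_betwE)
  \<comment> \<open>\<open>fro\<close> and \<open>tom\<close> carry matrices between natural-number
    indices and \<open>'n\<close> along the enumeration; \<open>fro\<close> respects products of
    matrices of this size, so it maps the similarity witnesses to inverse matrices.\<close>
  define fro :: "complex mat \<Rightarrow> complex^'n^'n" where "fro M = (\<chi> i j. M $$ (r i, r j))" for M
  define tom where "tom M = Matrix.mat ?n ?n (\<lambda>(i, j). M $ h i $ h j)" for M :: "complex^'n^'n"
  have fro_tom: "fro (tom M) = M" for M
    by (simp add: fro_def tom_def vec_eq_iff rn hr)
  have fro_mult: "fro (M * N) = fro M ** fro N"
    if M: "M \<in> carrier_mat ?n ?n" and N: "N \<in> carrier_mat ?n ?n" for M N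
  proof -
    have "(M * N) $$ (r i, r j) = (\<Sum>k\<in>UNIV. M $$ (r i, r k) * N $$ (r k, r j))" for i j
    proof -
      have "(M * N) $$ (r i, r j) = (\<Sum>k\<in>{0..<?n}. M $$ (r i, k) * N $$ (k, r j))"
        using M N rn[of i] rn[of j] by (auto simp: scalar_prod_def)
      also have "\<dots> = (\<Sum>k\<in>UNIV. M $$ (r i, r k) * N $$ (r k, r j))"
        by (rule sum.reindex_bij_betw[OF r, symmetric])
      finally show ?thesis .
    qed
    then show ?thesis by (simp add: fro_def matrix_matrix_mult_def)
  qed
  have fro_1: "fro (1\<^sub>m ?n) = mat 1"
    using rn r by (intro matrix_entry_eqI) (auto simp: fro_def Finite_Cartesian_Product.mat_def bij_betw_def inj_on_def)
  have A: "tom A \<in> carrier_mat ?n ?n" by (simp add: tom_def)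
  obtain as where "char_poly (tom A) = (\<Prod>a\<leftarrow>as. [:- a, 1:])"
    using char_poly_factorized[OF A] by blast
  then obtain n_as where jnf: "jordan_nf (tom A) n_as" using jordan_nf_exists[OF A] by blast
  let ?J = "jordan_matrix n_as"
  obtain P Q where "similar_mat_wit (tom A) ?J P Q"
    using jnf unfolding jordan_nf_def similar_mat_def by blast
  from similar_mat_witD2[OF A this]
  have PQ: "P * Q = 1\<^sub>m ?n" "Q * P = 1\<^sub>m ?n" "tom A = P * ?J * Q"
    and c: "?J \<in> carrier_mat ?n ?n" "P \<in> carrier_mat ?n ?n" "Q \<in> carrier_mat ?n ?n"
    by auto
  have inv: "fro P ** fro Q = mat 1" "fro Q ** fro P = mat 1"
    using PQ c by (simp_all flip: fro_mult fro_1)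
  have "matrix_inv (fro P) = fro Q"
    using inv by (rule matrix_inv_eqI)
  moreover have "A = fro P ** fro ?J ** fro Q"
    using arg_cong[OF PQ(3), of fro] c by (simp add: fro_tom fro_mult matrix_mul_assoc)
  moreover have "invertible (fro P)" using inv unfolding invertible_def by blast
  moreover have "inj r" using r by (simp add: bij_betw_def)
  moreover have sz: "sum_list (map fst n_as) = ?n"
    using c(1) jordan_matrix_dim[of n_as] by auto
  ultimately show thesis
    using jordan_matrix_entry[of _ n_as] rn
    by (intro that[of "fro P" "fro ?J" "\<lambda>i. ?J $$ (r i, r i)" r]) (simp_all add: fro_def block_triangular_def)
qed

section \<open>Matrix algebra and diagonal matrices\<close>

lemma bilinear_matrix_mul: "bilinear ((**) :: complex^'n^'n \<Rightarrow> complex^'n^'n \<Rightarrow> complex^'n^'n)"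
  unfolding bilinear_def linear_iff matrix_matrix_mult_def
  by (auto intro!: matrix_entry_eqI simp: sum.distrib distrib_left distrib_right scaleR_sum_right)

lemma bilinear_matrix_vector_mul: "bilinear ((*v) :: complex^'n^'n \<Rightarrow> complex^'n \<Rightarrow> complex^'n)"
  unfolding bilinear_def linear_iff matrix_vector_mult_def vec_eq_iff
  by (auto simp: sum.distrib distrib_left distrib_right scaleR_sum_right)

lemmas matrix_mul_algebra =
  bilinear_ladd[OF bilinear_matrix_mul] bilinear_radd[OF bilinear_matrix_mul]
  bilinear_lsub[OF bilinear_matrix_mul] bilinear_rsub[OF bilinear_matrix_mul]
  bilinear_lneg[OF bilinear_matrix_mul] bilinear_rneg[OF bilinear_matrix_mul]
  bilinear_lmul[OF bilinear_matrix_mul] bilinear_rmul[OF bilinear_matrix_mul]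

lemmas matrix_mul_zero [simp] = bilinear_lzero[OF bilinear_matrix_mul] bilinear_rzero[OF bilinear_matrix_mul]

lemmas matrix_vector_algebra =
  bilinear_ladd[OF bilinear_matrix_vector_mul] bilinear_radd[OF bilinear_matrix_vector_mul]
  bilinear_lsub[OF bilinear_matrix_vector_mul] bilinear_rsub[OF bilinear_matrix_vector_mul]
  bilinear_lneg[OF bilinear_matrix_vector_mul] bilinear_rneg[OF bilinear_matrix_vector_mul]
  bilinear_lmul[OF bilinear_matrix_vector_mul] bilinear_rmul[OF bilinear_matrix_vector_mul]

lemma matrix_vector_mult_smult: "(A :: complex^'n^'n) *v (c *s v) = c *s (A *v v)"
  by (simp add: vec.scale)

lemma matrix_vector_inv_left: "invertible P \<Longrightarrow> matrix_inv P *v (P *v x) = x"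
  and matrix_vector_inv_right: "invertible P \<Longrightarrow> P *v (matrix_inv P *v x) = x"
  for P :: "complex^'n^'n"
  by (simp_all add: matrix_vector_mul_assoc matrix_inv_left matrix_inv_right)

definition diag :: "('n \<Rightarrow> complex) \<Rightarrow> complex^'n^'n" where
  "diag d = (\<chi> i j. if i = j then d i else 0)"

lemma diag_vector: "(diag d *v v) $ i = d i * v $ i"
  by (simp add: diag_def matrix_vector_mult_def if_distrib[of "\<lambda>x. x * _"] cong: if_cong)

lemma matrix_vector_axis: "(A :: complex^'n^'n) *v axis i 1 = column i A"
  by (simp add: matrix_vector_mult_def axis_def column_def vec_eq_iff if_distrib cong: if_cong)

lemma matrix_eqI_axis:
  fixes A B :: "complex^'n^'n"
  assumes "\<And>j. A *v axis j 1 = B *v axis j 1"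
  shows "A = B"
proof (rule matrix_entry_eqI)
  fix i j
  have "column j A $ i = column j B $ i" using assms[of j] by (simp add: matrix_vector_axis)
  then show "A $ i $ j = B $ i $ j" by (simp add: column_def)
qed

lemma matrix_eqI: "(\<And>v. A *v v = B *v v) \<Longrightarrow> A = (B :: complex^'n^'n)"
  using matrix_eq by blast

section \<open>Generalized eigenvectors of derivations\<close>

text \<open>This is the kernel of \<open>(A - l)^m\<close>. Applying \<open>A - l\<close> to the
  vector before recursing lets inductions pass from \<open>v\<close> to \<open>(A - l) v\<close>
  without matrix powers.\<close>

primrec gen_eigenvec :: "nat \<Rightarrow> complex^'n^'n \<Rightarrow> complex \<Rightarrow> complex^'n \<Rightarrow> bool" where
  "gen_eigenvec 0 A l v \<longleftrightarrow> v = 0"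
| "gen_eigenvec (Suc m) A l v \<longleftrightarrow> gen_eigenvec m A l (A *v v - l *s v)"

lemma gen_eigenvec_zero: "gen_eigenvec m A l 0"
  by (induction m) simp_all

lemma gen_eigenvec_add:
  "gen_eigenvec m A l v \<Longrightarrow> gen_eigenvec m A l w \<Longrightarrow> gen_eigenvec m A l (v + w)"
proof (induction m arbitrary: v w)
  case (Suc m)
  have "A *v (v + w) - l *s (v + w) = (A *v v - l *s v) + (A *v w - l *s w)"
    by (simp add: matrix_vector_algebra vector_add_ldistrib)
  moreover have "gen_eigenvec m A l \<dots>"
    using Suc by simp
  ultimately show ?case by (metis gen_eigenvec.simps(2))
qed simp

lemma cbilinear_simps:
  assumes "cbilinear mu"
  shows "mu (x + y) z = mu x z + mu y z" "mu x (y + z) = mu x y + mu x z"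
    "mu (c *s x) y = c *s mu x y" "mu x (c *s y) = c *s mu x y"
    "mu (x - y) z = mu x z - mu y z" "mu x (y - z) = mu x y - mu x z"
    "mu (r *\<^sub>R x) y = r *\<^sub>R mu x y" "mu x (r *\<^sub>R y) = r *\<^sub>R mu x y"
    "mu 0 x = 0" "mu x 0 = 0"
proof -
  have *: "r *\<^sub>R x = complex_of_real r *s x" for r and x :: "complex^'a"
    by (simp add: vec_eq_iff scaleR_complex.code complex_eq_iff)
  have d: "x - y = x + (-1) *s y" for x y :: "complex^'a"
    by simp
  show a: "mu (x + y) z = mu x z + mu y z" "mu x (y + z) = mu x y + mu x z"
    "mu (c *s x) y = c *s mu x y" "mu x (c *s y) = c *s mu x y" for x y z c
    using assms by (simp_all add: cbilinear_def)
  show "mu (x - y) z = mu x z - mu y z" "mu x (y - z) = mu x y - mu x z"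
    unfolding d a by simp_all
  show "mu (r *\<^sub>R x) y = r *\<^sub>R mu x y" "mu x (r *\<^sub>R y) = r *\<^sub>R mu x y"
    unfolding * a by simp_all
  show "mu 0 x = 0" "mu x 0 = 0"
    using a(3)[of 0 x x] a(4)[of x 0 x] by simp_all
qed

text \<open>By Leibniz, \<open>A - (k + l)\<close> sends \<open>mu x y\<close> to the sum of
  \<open>mu ((A - k) x) y\<close> and \<open>mu x ((A - l) y)\<close>. Each application lowers one
  of the two heights, so \<open>p + q\<close> of them leave nothing.\<close>

lemma gen_eigenvec_product:
  assumes mu: "cbilinear mu" and A: "is_derivation mu A"
    and "gen_eigenvec p A k x" "gen_eigenvec q A l y"
  shows "gen_eigenvec (p + q) A (k + l) (mu x y)"
  using assms(3,4)
proof (induction "p + q" arbitrary: p q x y)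
  case 0
  then show ?case by (simp add: cbilinear_simps[OF mu])
next
  case (Suc m)
  let ?x = "A *v x - k *s x" and ?y = "A *v y - l *s y"
  have eq: "A *v mu x y - (k + l) *s mu x y = mu ?x y + mu x ?y"
    using A by (simp add: is_derivation_def cbilinear_simps[OF mu] vector_sadd_rdistrib)
  have "gen_eigenvec m A (k + l) (mu ?x y)"
  proof (cases p)
    case 0
    then show ?thesis using Suc.prems by (simp add: cbilinear_simps[OF mu] gen_eigenvec_zero)
  next
    case p: (Suc p')
    then show ?thesis using Suc.hyps(1)[of p' q ?x y] Suc.hyps(2) Suc.prems by simp
  qed
  moreover have "gen_eigenvec m A (k + l) (mu x ?y)"
  proof (cases q)
    case 0
    then show ?thesis using Suc.prems by (simp add: cbilinear_simps[OF mu] gen_eigenvec_zero)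
  next
    case q: (Suc q')
    then show ?thesis using Suc.hyps(1)[of p q' x ?y] Suc.hyps(2) Suc.prems by simp
  qed
  ultimately have "gen_eigenvec (Suc m) A (k + l) (mu x y)"
    unfolding gen_eigenvec.simps eq by (rule gen_eigenvec_add)
  then show ?case using Suc.hyps(2) by simp
qed

text \<open>On the support of \<open>v\<close> the diagonal part of \<open>B - l\<close> vanishes,
  and the other entries move a component to an index of strictly smaller rank.\<close>

lemma block_triangular_nilpotent_part:
  assumes B: "block_triangular B d r" and lv: "\<And>i. v $ i \<noteq> 0 \<Longrightarrow> d i = l \<and> r i < Suc m"
  shows "(B *v v - l *s v) $ i \<noteq> 0 \<Longrightarrow> d i = l \<and> r i < m"
proof -
  assume ne: "(B *v v - l *s v) $ i \<noteq> 0"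
  have *: "(B *v v - l *s v) $ i = (\<Sum>j\<in>UNIV - {i}. B $ i $ j * v $ j) + (d i - l) * v $ i"
    using B unfolding matrix_vector_mult_def block_triangular_def
    by (simp add: sum.remove[of UNIV i] algebra_simps)
  have "(d i - l) * v $ i = 0" using lv[of i] by auto
  with ne have "(\<Sum>j\<in>UNIV - {i}. B $ i $ j * v $ j) \<noteq> 0" unfolding * by simp
  then obtain j where "j \<noteq> i" "B $ i $ j \<noteq> 0" "v $ j \<noteq> 0"
    by (metis (no_types, lifting) DiffD2 insertI1 mult_eq_0_iff sum.neutral)
  then have "d i = l" "r i \<le> r j" "r i \<noteq> r j" "r j < Suc m"
    using B lv[of j] by (auto simp: block_triangular_def inj_eq)
  then show ?thesis by simp
qed

lemma block_triangular_gen_eigenvec: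
  assumes B: "block_triangular B d r" and "\<And>i. v $ i \<noteq> 0 \<Longrightarrow> d i = l \<and> r i < m"
  shows "gen_eigenvec m B l v"
  using assms(2)
proof (induction m arbitrary: v)
  case 0
  then show ?case by (auto simp: vec_eq_iff)
next
  case (Suc m)
  have "gen_eigenvec m B l (B *v v - l *s v)"
    by (rule Suc.IH) (rule block_triangular_nilpotent_part[OF B Suc.prems])
  then show ?case by simp
qed

text \<open>Among the support indices with eigenvalue other than \<open>l\<close> take one,
  \<open>j\<close>, of maximal rank. No other component of \<open>v\<close> feeds into it, so
  \<open>B - l\<close> multiplies it by the nonzero \<open>d j - l\<close> and it never
  dies.\<close>

lemma block_triangular_gen_eigenvec_support:
  assumes B: "block_triangular B d r" and "gen_eigenvec m B l v" "v $ i \<noteq> 0"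
  shows "d i = l"
  using assms(2,3)
proof (induction m arbitrary: v i)
  case 0
  then show ?case by simp
next
  case (Suc m)
  let ?w = "B *v v - l *s v"
  show ?case
  proof (rule ccontr)
    assume "d i \<noteq> l"
    let ?S = "{j. d j \<noteq> l \<and> v $ j \<noteq> 0}"
    have "finite (r ` ?S)" "r ` ?S \<noteq> {}" using \<open>d i \<noteq> l\<close> Suc.prems by auto
    then obtain j where j: "j \<in> ?S" "r j = Max (r ` ?S)"
      using Max_in by (metis (no_types, lifting) imageE)
    have le: "r k \<le> r j" if "k \<in> ?S" for k
      using that unfolding j(2) by (intro Max_ge) auto
    have "B $ j $ k * v $ k = 0" if "k \<noteq> j" for k
    proof (rule ccontr)
      assume "\<not> ?thesis"
      then have "k \<in> ?S" "r j \<le> r k" using B j(1) by (auto simp: block_triangular_def)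
      then have "r j = r k" using le by (auto intro: antisym)
      then show False using that B by (auto simp: block_triangular_def inj_eq)
    qed
    then have "(\<Sum>k\<in>UNIV - {j}. B $ j $ k * v $ k) = 0" by (intro sum.neutral) auto
    then have "?w $ j = (d j - l) * v $ j"
      using B unfolding matrix_vector_mult_def block_triangular_def
      by (simp add: sum.remove[of UNIV j] algebra_simps)
    then show False using Suc.IH[of ?w j] Suc.prems j(1) by auto
  qed
qed

lemma gen_eigenvec_conjugate:
  fixes P :: "complex^'n^'n"
  assumes P: "invertible P"
  shows "gen_eigenvec m (P ** B ** matrix_inv P) l v \<longleftrightarrow> gen_eigenvec m B l (matrix_inv P *v v)"
proof (induction m arbitrary: v)
  case 0
  then show ?case using matrix_vector_inv_right[OF P, of v] by auto
next
  case (Suc m)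
  have "matrix_inv P *v ((P ** B ** matrix_inv P) *v v - l *s v) =
      B *v (matrix_inv P *v v) - l *s (matrix_inv P *v v)"
    by (simp add: matrix_vector_algebra matrix_vector_mult_smult matrix_vector_inv_left[OF P]
        flip: matrix_vector_mul_assoc)
  then show ?case using Suc by simp
qed

text \<open>On the generalized eigenspace of \<open>A\<close> for \<open>l\<close> the new matrix is
  the scalar \<open>f l\<close>. Products from the eigenspaces for \<open>k\<close> and
  \<open>l\<close> land in the one for \<open>k + l\<close>, so Leibniz reduces to
  \<open>f (k + l) = f k + f l\<close>.\<close>

lemma is_derivation_semisimple_replica:
  fixes P :: "complex^'n^'n"
  assumes mu: "cbilinear mu" and A: "is_derivation mu A"
    and P: "invertible P" and PA: "A = P ** B ** matrix_inv P" and B: "block_triangular B d r"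
    and f: "\<And>a b. f (a + b) = f a + f b"
  shows "is_derivation mu (P ** diag (\<lambda>i. f (d i)) ** matrix_inv P)"
proof -
  let ?S = "P ** diag (\<lambda>i. f (d i)) ** matrix_inv P"
  have S: "?S *v v = f l *s v" if "gen_eigenvec m A l v" for m l v
  proof -
    let ?c = "matrix_inv P *v v"
    have "gen_eigenvec m B l ?c" using that gen_eigenvec_conjugate[OF P] PA by simp
    then have "d i = l \<or> ?c $ i = 0" for i
      using block_triangular_gen_eigenvec_support[OF B] by blast
    then have "diag (\<lambda>i. f (d i)) *v ?c = f l *s ?c"
      unfolding vec_eq_iff diag_vector by (metis mult_zero_right vector_smult_component)
    then show ?thesis
      by (simp add: matrix_vector_mult_smult matrix_vector_inv_right[OF P] flip: matrix_vector_mul_assoc)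
  qed
  \<comment> \<open>The columns of \<open>P\<close> form a basis of generalized eigenvectors. With
    the factor \<open>c\<close> included here, \<open>der\<close> below has to be closed under sums
    only.\<close>
  have gen: "gen_eigenvec (Suc (r i)) A (d i) (c *s column i P)" for i c
  proof -
    have "matrix_inv P *v (c *s column i P) = c *s axis i 1"
      using matrix_vector_inv_left[OF P, of "axis i 1"]
      by (simp add: matrix_vector_mult_smult matrix_vector_axis)
    then show ?thesis
      unfolding PA gen_eigenvec_conjugate[OF P]
      by (intro block_triangular_gen_eigenvec[OF B]) (auto simp: axis_def split: if_splits)
  qed
  have exp: "v = (\<Sum>i\<in>UNIV. (matrix_inv P *v v) $ i *s column i P)" for v
    by (rule trans[OF sym[OF matrix_vector_inv_right[OF P]] matrix_mult_sum])
  define der where "der x y \<longleftrightarrow> ?S *v mu x y = mu (?S *v x) y + mu x (?S *v y)" for x y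
  have der_add: "der x y \<Longrightarrow> der x y' \<Longrightarrow> der x (y + y')" "der x y \<Longrightarrow> der x' y \<Longrightarrow> der (x + x') y"
    and der_0: "der 0 y" "der x 0" for x x' y y'
    by (simp_all add: der_def cbilinear_simps[OF mu] matrix_vector_algebra)
  have der_gen: "der x y" if "gen_eigenvec p A k x" "gen_eigenvec q A l y" for p q k l x y
    using S[OF that(1)] S[OF that(2)] S[OF gen_eigenvec_product[OF mu A that]]
    by (simp add: der_def f cbilinear_simps[OF mu] vector_sadd_rdistrib)
  have der_sum1: "der (\<Sum>i\<in>I. x i) y" if "\<And>i. i \<in> I \<Longrightarrow> der (x i) y" for I y and x :: "'a \<Rightarrow> _"
    using that by (induction I rule: infinite_finite_induct) (auto simp: der_add der_0)
  have der_sum2: "der x (\<Sum>i\<in>I. y i)" if "\<And>i. i \<in> I \<Longrightarrow> der x (y i)" for I x and y :: "'a \<Rightarrow> _"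
    using that by (induction I rule: infinite_finite_induct) (auto simp: der_add der_0)
  have "der x y" for x y
  proof -
    have "der (\<Sum>i\<in>UNIV. (matrix_inv P *v x) $ i *s column i P)
        (\<Sum>i\<in>UNIV. (matrix_inv P *v y) $ i *s column i P)" (is "der ?a ?b")
      by (intro der_sum1 der_sum2 der_gen[OF gen gen])
    then show ?thesis by (simp only: exp[of x, symmetric] exp[of y, symmetric])
  qed
  then show ?thesis unfolding is_derivation_def der_def by blast
qed

section \<open>Engel's theorem\<close>

text \<open>\<open>flag K b\<close> is spanned by the values of products of \<open>b\<close>
  elements of \<open>K\<close>. Its vanishing for some \<open>b\<close> is the basis-free form of
  simultaneous strict triangularity.\<close>

primrec flag :: "(complex^'n^'n) set \<Rightarrow> nat \<Rightarrow> (complex^'n) set" where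
  "flag K 0 = UNIV"
| "flag K (Suc b) = span {k *v v |k v. k \<in> K \<and> v \<in> flag K b}"

lemma subspace_flag: "subspace (flag K b)"
  by (cases b) simp_all

lemma flag_step: "k \<in> K \<Longrightarrow> v \<in> flag K b \<Longrightarrow> k *v v \<in> flag K (Suc b)"
  by (auto intro: span_base)

lemma flag_Suc_subset: "flag K (Suc b) \<subseteq> flag K b"
proof (induction b)
  case (Suc b)
  then show ?case
    unfolding flag.simps(2)[of K "Suc b"] flag.simps(2)[of K b] by (intro span_mono) blast
qed simp

lemma flag_antimono: "a \<le> b \<Longrightarrow> flag K b \<subseteq> flag K a"
  by (rule lift_Suc_antimono_le[of "flag K"]) (rule flag_Suc_subset)

lemma linear_matrix_vector: "linear ((*v) (A :: complex^'n^'n))"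
  using bilinear_matrix_vector_mul by (simp add: bilinear_def)

text \<open>Moving \<open>y\<close> past \<open>k\<close> costs a commutator:
  \<open>y k v = k y v + [y, k] v\<close>, and both terms lie one step down the flag.\<close>

lemma flag_normalizer:
  assumes y: "\<And>k. k \<in> K \<Longrightarrow> y ** k - k ** y \<in> K" and v: "v \<in> flag K b"
  shows "y *v v \<in> flag K b"
  using v
proof (induction b arbitrary: v)
  case 0
  then show ?case by simp
next
  case (Suc b)
  have "{k *v v |k v. k \<in> K \<and> v \<in> flag K b} \<subseteq> {v. y *v v \<in> flag K (Suc b)}"
  proof clarify
    fix k v
    assume kv: "k \<in> K" "v \<in> flag K b"
    have "y *v (k *v v) = k *v (y *v v) + (y ** k - k ** y) *v v"
      by (simp add: matrix_vector_algebra matrix_vector_mul_assoc)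
    also have "\<dots> \<in> flag K (Suc b)"
      using flag_step[OF kv(1) Suc.IH[OF kv(2)]] flag_step[OF y[OF kv(1)] kv(2)]
      by (rule subspace_add[OF subspace_flag])
    finally show "y *v (k *v v) \<in> flag K (Suc b)" .
  qed
  moreover have "subspace {v. y *v v \<in> flag K (Suc b)}"
    using linear_subspace_vimage[OF linear_matrix_vector subspace_flag[of K "Suc b"], of y]
    by (simp add: vimage_def del: flag.simps)
  ultimately have "flag K (Suc b) \<subseteq> {v. y *v v \<in> flag K (Suc b)}"
    unfolding flag.simps(2)[of K b] by (rule span_minimal)
  then show ?case using Suc.prems by blast
qed

definition nilpotent :: "complex^'n^'n \<Rightarrow> bool" where
  "nilpotent A \<longleftrightarrow> (\<exists>m. \<forall>v. ((*v) A ^^ m) v = 0)"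

lemma linear_matrix_vector_funpow: "linear ((*v) (A :: complex^'n^'n) ^^ m)"
proof (induction m)
  case 0
  then show ?case by (simp add: linear_iff)
next
  case (Suc m)
  then show ?case by (auto simp: linear_iff matrix_vector_algebra)
qed

text \<open>\<open>K\<close> maps \<open>flag K b\<close> into the next step, so modulo that step
  \<open>k + t y\<close> acts as \<open>t y\<close>. As \<open>y\<close> is nilpotent, finitely many
  factors from \<open>K'\<close> push \<open>flag K b\<close> into
  \<open>flag K (Suc b)\<close>.\<close>

lemma flag_extend:
  assumes y: "\<And>k. k \<in> K \<Longrightarrow> y ** k - k ** y \<in> K" and "flag K N \<subseteq> {0}" and "nilpotent y"
    and K': "\<And>k'. k' \<in> K' \<Longrightarrow> \<exists>k\<in>K. \<exists>t. k' = k + t *\<^sub>R y"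
  shows "\<exists>N'. flag K' N' \<subseteq> {0}"
proof -
  from \<open>nilpotent y\<close> obtain M where M: "\<And>v. ((*v) y ^^ M) v = 0" by (auto simp: nilpotent_def)
  have "\<exists>m. flag K' m \<subseteq> flag K b" for b
  proof (induction b)
    case 0
    then show ?case by simp
  next
    case (Suc b)
    then obtain m where m: "flag K' m \<subseteq> flag K b" by blast
    \<comment> \<open>\<open>U a\<close> bounds the flag of \<open>K'\<close> after \<open>a\<close>
      further factors: the image under the \<open>a\<close>-th power of \<open>y\<close>, modulo the
      next step.\<close>
    define U where "U a = {v + w |v w. v \<in> ((*v) y ^^ a) ` flag K b \<and> w \<in> flag K (Suc b)}" for a
    have U: "subspace (U a)" for a
      unfolding U_def
      by (intro subspace_sums linear_subspace_image linear_matrix_vector_funpow subspace_flag)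
    have "flag K' (m + a) \<subseteq> U a" for a
    proof (induction a)
      case 0
      have "v \<in> U 0" if "v \<in> flag K b" for v
        using that subspace_0[OF subspace_flag, of K "Suc b"] unfolding U_def by force
      then show ?case using m by auto
    next
      case (Suc a)
      have "{k *v v |k v. k \<in> K' \<and> v \<in> flag K' (m + a)} \<subseteq> U (Suc a)"
      proof clarify
        fix k' u
        assume "k' \<in> K'" "u \<in> flag K' (m + a)"
        then obtain k t v w where k: "k \<in> K" "k' = k + t *\<^sub>R y"
          and v: "v \<in> flag K b" and w: "w \<in> flag K (Suc b)" and u: "u = ((*v) y ^^ a) v + w"
          using K'[of k'] Suc.IH unfolding U_def by blast
        have va: "((*v) y ^^ a) v \<in> flag K b"
          using v by (induction a) (auto intro: flag_normalizer[OF y])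
        have "k *v u \<in> flag K (Suc b)"
          unfolding u using va w flag_Suc_subset[of K b]
          by (intro flag_step k subspace_add[OF subspace_flag]) auto
        then have "k *v u + t *\<^sub>R (y *v w) \<in> flag K (Suc b)"
          by (intro subspace_add[OF subspace_flag] subspace_scale[OF subspace_flag] flag_normalizer[OF y] w)
        moreover have "((*v) y ^^ Suc a) (t *\<^sub>R v) \<in> ((*v) y ^^ Suc a) ` flag K b"
          using v by (intro imageI subspace_scale[OF subspace_flag])
        moreover have "k' *v u = ((*v) y ^^ Suc a) (t *\<^sub>R v) + (k *v u + t *\<^sub>R (y *v w))"
          using linear_cmul[OF linear_matrix_vector_funpow[of a y]]
          by (simp add: k u matrix_vector_algebra algebra_simps)
        ultimately show "k' *v u \<in> U (Suc a)" unfolding U_def by blast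
      qed
      then show ?case using U by (simp add: span_minimal)
    qed
    from this[of M] have "flag K' (m + M) \<subseteq> flag K (Suc b)"
      unfolding U_def by (auto simp: M simp del: flag.simps)
    then show ?case by blast
  qed
  then show ?thesis using assms(2) by blast
qed

text \<open>Engel's theorem, after Jacobson: a maximal subalgebra K whose flag terminates is all of L,
  since otherwise repeatedly bracketing an element outside K with elements of K, which annihilates
  it eventually, stops at an element of L - K that normalizes K.\<close>

theorem Engel_flag:
  assumes L: "subspace L" "\<And>x y. x \<in> L \<Longrightarrow> y \<in> L \<Longrightarrow> x ** y - y ** x \<in> L"
    and nil: "\<And>x. x \<in> L \<Longrightarrow> nilpotent x"
  shows "\<exists>N. flag L N \<subseteq> {0}"
proof -
  define P where "P K \<longleftrightarrow> subspace K \<and> K \<subseteq> L \<and> (\<forall>x\<in>K. \<forall>y\<in>K. x ** y - y ** x \<in> K) \<and>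
    (\<exists>N. flag K N \<subseteq> {0})" for K
  have "flag {0 :: complex^'a^'a} (Suc 0) \<subseteq> {0}" by simp
  then have "\<exists>N. flag {0 :: complex^'a^'a} N \<subseteq> {0}" ..
  then have "P {0}" using subspace_0[OF L(1)] unfolding P_def by simp
  moreover have "\<forall>K. P K \<longrightarrow> dim K < Suc DIM(complex^'a^'a)"
    unfolding less_Suc_eq_le by (intro allI impI dim_subset_UNIV)
  ultimately obtain K where K: "P K" and max: "\<And>K'. P K' \<Longrightarrow> dim K' \<le> dim K"
    using ex_has_greatest_nat[of P "{0}" dim] by blast
  from K have sub: "subspace K" "K \<subseteq> L" and br: "\<And>x y. x \<in> K \<Longrightarrow> y \<in> K \<Longrightarrow> x ** y - y ** x \<in> K"
    unfolding P_def by auto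
  from K obtain N where N: "flag K N \<subseteq> {0}" unfolding P_def by auto
  have "L \<subseteq> K"
  proof (rule ccontr)
    assume "\<not> L \<subseteq> K"
    then obtain x where x: "x \<in> L" "x \<notin> K" by blast
    have "\<exists>y\<in>L - K. \<forall>k\<in>K. y ** k - k ** y \<in> K"
    proof (rule ccontr)
      assume "\<not> ?thesis"
      then have ex: "\<exists>k\<in>K. y ** k - k ** y \<notin> K" if "y \<in> L" "y \<notin> K" for y using that by blast
      \<comment> \<open>Natural subtraction: for \<open>m = 0\<close> the target is the whole space
        when \<open>b < N\<close>, and otherwise \<open>v = 0\<close>. Each bracket with a suitable
        element of \<open>K\<close> raises the shift by one and stays outside
        \<open>K\<close>.\<close>
      have "\<exists>y. y \<in> L \<and> y \<notin> K \<and> (\<forall>b. \<forall>v\<in>flag K b. y *v v \<in> flag K (b + m + 1 - N))" for m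
      proof (induction m)
        case 0
        have "x *v v \<in> flag K (b + 0 + 1 - N)" if "v \<in> flag K b" for b v
        proof (cases "b < N")
          case True
          then have "b + 0 + 1 - N = 0" by simp
          then show ?thesis by (simp only: flag.simps) simp
        next
          case False
          then have "v = 0" using that N flag_antimono[of N b K] by auto
          then show ?thesis using subspace_0[OF subspace_flag] by simp
        qed
        then show ?case using x by blast
      next
        case (Suc m)
        then obtain y where y: "y \<in> L" "y \<notin> K"
          and yf: "\<And>b v. v \<in> flag K b \<Longrightarrow> y *v v \<in> flag K (b + m + 1 - N)" by blast
        obtain k where k: "k \<in> K" "y ** k - k ** y \<notin> K" using ex y by blast
        let ?z = "y ** k - k ** y"
        have "?z *v v \<in> flag K (b + Suc m + 1 - N)" if v: "v \<in> flag K b" for b v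
        proof -
          have "y *v (k *v v) \<in> flag K (b + Suc m + 1 - N)"
            using yf[OF flag_step[OF k(1) v]] by simp
          moreover have "k *v (y *v v) \<in> flag K (b + Suc m + 1 - N)"
            by (rule subsetD[OF flag_antimono flag_step[OF k(1) yf[OF v]]]) simp
          ultimately have "y *v (k *v v) - k *v (y *v v) \<in> flag K (b + Suc m + 1 - N)"
            by (rule subspace_diff[OF subspace_flag])
          then show ?thesis by (simp add: matrix_vector_algebra matrix_vector_mul_assoc)
        qed
        moreover have "?z \<in> L" using y(1) k(1) sub(2) by (intro L) auto
        ultimately show ?case using k(2) by blast
      qed
      \<comment> \<open>For \<open>m = 2 * N\<close> and \<open>b = 0\<close> the target is step
        \<open>N + 1\<close>, which is zero; so \<open>y = 0\<close>, which belongs to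
        \<open>K\<close>.\<close>
      from this[of "2 * N"] obtain y where "y \<notin> K"
        and yf: "\<And>b v. v \<in> flag K b \<Longrightarrow> y *v v \<in> flag K (b + 2 * N + 1 - N)" by blast
      have "y *v v = 0 *v v" for v
        using yf[of v 0] flag_antimono[of N "0 + 2 * N + 1 - N" K] N by auto
      then have "y = 0" by (rule matrix_eqI)
      then show False using \<open>y \<notin> K\<close> subspace_0[OF sub(1)] by simp
    qed
    then obtain y where y: "y \<in> L" "y \<notin> K" and norm: "\<And>k. k \<in> K \<Longrightarrow> y ** k - k ** y \<in> K" by blast
    let ?K = "span (insert y K)"
    have K': "\<exists>k\<in>K. \<exists>t. k' = k + t *\<^sub>R y" if k': "k' \<in> ?K" for k'
    proof -
      have "span K = K" using sub(1) by (simp add: span_eq_iff)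
      then obtain t where "k' - t *\<^sub>R y \<in> K" using k' unfolding span_insert \<open>span K = K\<close> by auto
      then show ?thesis by (intro bexI[of _ "k' - t *\<^sub>R y"] exI[of _ t]) simp_all
    qed
    have "?K \<subseteq> L" using y sub L(1) by (intro span_minimal) auto
    moreover have "\<exists>N'. flag ?K N' \<subseteq> {0}"
      by (rule flag_extend[OF norm N nil[OF y(1)] K'])
    moreover have "p ** q - q ** p \<in> ?K" if "p \<in> ?K" "q \<in> ?K" for p q
    proof -
      obtain k t l s where p: "k \<in> K" "p = k + t *\<^sub>R y" and q: "l \<in> K" "q = l + s *\<^sub>R y"
        using K' \<open>p \<in> ?K\<close> \<open>q \<in> ?K\<close> by metis
      have "p ** q - q ** p = (k ** l - l ** k) + t *\<^sub>R (y ** l - l ** y) - s *\<^sub>R (y ** k - k ** y)"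
        unfolding p q by (simp add: matrix_mul_algebra algebra_simps)
      also have "\<dots> \<in> K"
        using p(1) q(1) sub(1)
        by (intro subspace_add subspace_diff subspace_scale br norm) auto
      finally show ?thesis by (rule subsetD[OF order.trans[OF subset_insertI span_superset]])
    qed
    ultimately have "P ?K" unfolding P_def by auto
    then have "dim ?K \<le> dim K" by (rule max)
    then have "K = ?K"
      using sub(1) by (intro subspace_dim_equal) (auto intro: span_base)
    then show False using y(2) span_base[of y "insert y K"] by blast
  qed
  then show ?thesis using K sub(2) unfolding P_def by auto
qed

text \<open>By \<open>ss\<close>, \<open>T\<close> is injective on its image, hence bijective on the
  image of \<open>W\<close>, and \<open>T x = T (T y)\<close> is solvable. So \<open>W\<close> is
  the sum of its kernel and its image; this is applied to \<open>ad\<close> of a semisimple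
  derivation.\<close>

lemma kernel_plus_image:
  fixes T :: "'a :: euclidean_space \<Rightarrow> 'a"
  assumes T: "linear T" and W: "subspace W" "T ` W \<subseteq> W"
    and ss: "\<And>x. T (T x) = 0 \<Longrightarrow> T x = 0" and x: "x \<in> W"
  obtains y where "y \<in> W" "T (x - T y) = 0"
proof -
  let ?V = "T ` W"
  have V: "subspace ?V" "subspace (T ` ?V)" using T W by (simp_all add: linear_subspace_image)
  have "inj_on T ?V"
    unfolding linear_injective_on_subspace_0[OF T V(1)] using ss by auto
  then have "inj_on T (span ?V)" using V by (metis span_eq_iff)
  then have "dim (T ` ?V) = dim ?V" by (rule dim_image_eq[OF T])
  then have "T ` ?V = ?V" using V W by (intro subspace_dim_equal) auto
  then have "T x \<in> T ` ?V" using x by auto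
  then obtain y where "y \<in> W" "T x = T (T y)" by auto
  then show thesis using that linear_diff[OF T] by auto
qed

section \<open>Semisimple matrices and traces\<close>

definition semisimple :: "complex^'n^'n \<Rightarrow> bool" where
  "semisimple A \<longleftrightarrow> (\<exists>(P :: complex^'n^'n) d. invertible P \<and> A = P ** diag d ** matrix_inv P)"

lemma matrix_conjugate_mult:
  fixes P :: "complex^'n^'n"
  assumes "invertible P"
  shows "(P ** X ** matrix_inv P) ** (P ** Y ** matrix_inv P) = P ** (X ** Y) ** matrix_inv P"
  using matrix_inv_left[OF assms] by (metis matrix_mul_assoc matrix_mul_lid)

lemma matrix_conjugate_cancel:
  fixes P :: "complex^'n^'n"
  assumes "invertible P"
  shows "P ** (matrix_inv P ** X ** P) ** matrix_inv P = X"
  using matrix_inv_right[OF assms] by (metis matrix_mul_assoc matrix_mul_lid matrix_mul_rid)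

lemma diag_mult_left: "(diag d ** A) $ i $ j = d i * A $ i $ j"
  by (simp add: diag_def matrix_matrix_mult_def if_distrib[of "\<lambda>x. x * _"] cong: if_cong)

lemma diag_mult_right: "(A ** diag d) $ i $ j = A $ i $ j * d j"
  by (simp add: diag_def matrix_matrix_mult_def if_distrib[of "\<lambda>x. _ * x"] cong: if_cong)

text \<open>In an eigenbasis of \<open>A\<close>, \<open>ad A\<close> multiplies the entry at
  \<open>i\<close>, \<open>j\<close> by \<open>d i - d j\<close>, and multiplying twice by a number
  kills an entry only if multiplying once does.\<close>

lemma semisimple_ad:
  assumes "semisimple A" and "A ** (A ** X - X ** A) - (A ** X - X ** A) ** A = 0"
  shows "A ** X - X ** A = 0"
proof -
  obtain P :: "complex^'a^'a" and d where P: "invertible P" and A: "A = P ** diag d ** matrix_inv P"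
    using assms(1) unfolding semisimple_def by blast
  define ad where "ad Y = diag d ** Y - Y ** diag d" for Y :: "complex^'a^'a"
  define Y where "Y = matrix_inv P ** X ** P"
  have eq: "A ** (P ** Z ** matrix_inv P) - (P ** Z ** matrix_inv P) ** A = P ** ad Z ** matrix_inv P" for Z
    unfolding A matrix_conjugate_mult[OF P] ad_def by (simp add: matrix_mul_algebra)
  have X: "X = P ** Y ** matrix_inv P" unfolding Y_def matrix_conjugate_cancel[OF P] ..
  have inj: "Z = 0" if "P ** Z ** matrix_inv P = 0" for Z
  proof -
    have "matrix_inv P ** (P ** Z ** matrix_inv P) ** P = (matrix_inv P ** P) ** Z ** (matrix_inv P ** P)"
      by (simp only: matrix_mul_assoc)
    then show ?thesis using that by (simp add: matrix_inv_left[OF P])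
  qed
  have "ad (ad Y) = 0" by (rule inj) (use assms(2) X eq in simp)
  then have "(ad (ad Y)) $ i $ j = 0" for i j by simp
  then have "(d i - d j) * ((d i - d j) * Y $ i $ j) = 0" for i j
    by (simp add: ad_def diag_mult_left diag_mult_right algebra_simps)
  then have "(d i - d j) * Y $ i $ j = 0" for i j
    by (metis mult_eq_0_iff)
  then have "ad Y = 0"
    by (intro matrix_entry_eqI) (simp add: ad_def diag_mult_left diag_mult_right algebra_simps)
  then show ?thesis unfolding X eq by simp
qed

lemma linear_ad: "linear (\<lambda>X. A ** X - X ** (A :: complex^'n^'n))"
  by (simp add: linear_iff matrix_mul_algebra scaleR_diff_right)

lemma trace_conjugate:
  fixes P :: "complex^'n^'n"
  assumes "invertible P"
  shows "trace (P ** X ** matrix_inv P) = trace X"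
  using trace_mul_sym[of "P ** X" "matrix_inv P"] by (simp add: matrix_mul_assoc matrix_inv_left[OF assms])

lemma trace_diag_mult: "trace (diag d ** A) = (\<Sum>i\<in>UNIV. d i * A $ i $ i)"
  by (simp add: trace_def diag_mult_left)

lemma trace_commutator: "trace (A ** B - B ** A) = 0" for A B :: "complex^'n^'n"
  using trace_mul_sym[of A B] by (simp add: trace_sub)

lemma gen_eigenvec_0_iff: "gen_eigenvec m A 0 v \<longleftrightarrow> ((*v) A ^^ m) v = 0"
  by (induction m arbitrary: v) (simp_all add: funpow_swap1)

lemma nilpotent_iff_eigenvalues:
  fixes P :: "complex^'n^'n"
  assumes P: "invertible P" and B: "block_triangular B d r"
  shows "nilpotent (P ** B ** matrix_inv P) \<longleftrightarrow> (\<forall>i. d i = 0)"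
proof
  assume "nilpotent (P ** B ** matrix_inv P)"
  then obtain m where m: "\<And>v. gen_eigenvec m (P ** B ** matrix_inv P) 0 v"
    unfolding nilpotent_def gen_eigenvec_0_iff by blast
  show "\<forall>i. d i = 0"
  proof
    fix i
    have "gen_eigenvec m B 0 (axis i 1)"
      using m[of "P *v axis i 1"] unfolding gen_eigenvec_conjugate[OF P] matrix_vector_inv_left[OF P] .
    then show "d i = 0" by (rule block_triangular_gen_eigenvec_support[OF B, where i = i]) simp
  qed
next
  assume d: "\<forall>i. d i = 0"
  have "r i < Suc (Max (range r))" for i by (simp add: less_Suc_eq_le)
  then have "gen_eigenvec (Suc (Max (range r))) (P ** B ** matrix_inv P) 0 v" for v
    unfolding gen_eigenvec_conjugate[OF P] using d by (intro block_triangular_gen_eigenvec[OF B]) auto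
  then show "nilpotent (P ** B ** matrix_inv P)"
    unfolding nilpotent_def gen_eigenvec_0_iff by blast
qed

lemma nilpotent_trace:
  assumes "nilpotent A"
  shows "trace A = 0"
proof -
  obtain P B :: "complex^'a^'a" and d r where P: "invertible P" "A = P ** B ** matrix_inv P" and B: "block_triangular B d r"
    by (rule jordan_decomposition[of A])
  then have "B $ i $ i = 0" for i
    using assms nilpotent_iff_eigenvalues[OF P(1) B] by (simp add: block_triangular_def)
  then show ?thesis using trace_conjugate[OF P(1), of B] P(2) by (simp add: trace_def)
qed

section \<open>The trace form as a Euclidean inner product\<close>

lemma Re_trace_eq_inner: "Re (trace (A ** B)) = adjoint_mat A \<bullet> B"
proof -
  have "Re (trace (A ** B)) = (\<Sum>i\<in>UNIV. \<Sum>j\<in>UNIV. Re (A $ i $ j * B $ j $ i))"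
    by (simp add: trace_def matrix_matrix_mult_def)
  also have "\<dots> = (\<Sum>i\<in>UNIV. \<Sum>j\<in>UNIV. Re (A $ j $ i * B $ i $ j))"
    by (rule sum.swap)
  also have "\<dots> = adjoint_mat A \<bullet> B"
    by (simp add: inner_vec_def inner_complex_def adjoint_mat_def)
  finally show ?thesis .
qed

text \<open>The real trace is the inner product with the identity, so a representative exists iff
  the identity lies in the sum of the adjoints of \<open>W\<close> and the orthogonal complement of
  \<open>W\<close>. The component \<open>z\<close> of the identity orthogonal to this sum lies in
  \<open>W\<close> and in the radical of the form; \<open>rad\<close> then makes it orthogonal to
  the identity, hence zero.\<close>

lemma trace_form_represents:
  fixes W :: "(complex^'n^'n) set"
  assumes W: "subspace W"
    and rad: "\<And>y. y \<in> W \<Longrightarrow> (\<And>x. x \<in> W \<Longrightarrow> Re (trace (x ** y)) = 0) \<Longrightarrow> Re (trace y) = 0"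
  obtains x where "x \<in> W" "\<And>y. y \<in> W \<Longrightarrow> Re (trace (x ** y)) = Re (trace y)"
proof -
  define Wp where "Wp = {z. \<forall>w\<in>W. orthogonal z w}"
  let ?U = "{a + b |a b. a \<in> adjoint_mat ` W \<and> b \<in> Wp}"
  have "linear (adjoint_mat :: complex^'n^'n \<Rightarrow> _)"
    unfolding linear_iff by (auto intro!: matrix_entry_eqI simp: adjoint_mat_def)
  then have aW: "subspace (adjoint_mat ` W)" using W by (rule linear_subspace_image)
  have Wp: "subspace Wp"
    unfolding Wp_def real_vector.subspace_def orthogonal_def by (auto simp: inner_add_left)
  have U: "span ?U = ?U" using aW Wp by (simp add: span_eq_iff subspace_sums)
  obtain u z where u: "u \<in> ?U" and z: "\<And>w. w \<in> ?U \<Longrightarrow> orthogonal z w" and uz: "mat 1 = u + z"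
    using orthogonal_subspace_decomp_exists[of ?U "mat 1 :: complex^'n^'n"] unfolding U by blast
  have za: "z \<bullet> adjoint_mat x = 0" if "x \<in> W" for x
    using z[of "adjoint_mat x"] that subspace_0[OF Wp] unfolding orthogonal_def by force
  have zp: "z \<bullet> b = 0" if "b \<in> Wp" for b
    using z[of b] that subspace_0[OF aW] unfolding orthogonal_def by force
  have "z \<in> W"
  proof -
    obtain a b where a: "a \<in> span W" and b: "\<And>w. w \<in> span W \<Longrightarrow> orthogonal b w" and ab: "z = a + b"
      using orthogonal_subspace_decomp_exists[of W z] by blast
    have "b \<in> Wp" unfolding Wp_def using b by (auto intro: span_base)
    then have "(a + b) \<bullet> b = 0" "a \<bullet> b = 0"
      using zp[of b] b[OF a] unfolding ab orthogonal_def by (simp_all add: inner_commute)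
    then have "b \<bullet> b = 0" by (simp add: inner_add_left)
    then show ?thesis using a ab W by (simp add: span_eq_iff[THEN iffD2])
  qed
  have one: "mat 1 \<bullet> y = Re (trace y)" for y :: "complex^'n^'n"
  proof -
    have "adjoint_mat (mat 1 :: complex^'n^'n) = mat 1"
      by (rule matrix_entry_eqI) (simp add: adjoint_mat_def mat_def)
    then show ?thesis using Re_trace_eq_inner[of "mat 1" y] by simp
  qed
  have "Re (trace z) = 0"
    by (rule rad[OF \<open>z \<in> W\<close>]) (use za in \<open>simp add: Re_trace_eq_inner inner_commute\<close>)
  moreover have "z \<bullet> u = 0" using z[OF u] by (simp add: orthogonal_def)
  ultimately have "z \<bullet> z = 0"
    using one[of z] unfolding uz by (simp add: inner_add_left inner_commute[of u z])
  then have "mat 1 \<in> ?U" using u uz by simp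
  then obtain x b where x: "x \<in> W" "mat 1 = adjoint_mat x + b" "b \<in> Wp" by blast
  have "Re (trace (x ** y)) = Re (trace y)" if "y \<in> W" for y
    using one[of y] x(3) that unfolding Re_trace_eq_inner x(2)
    by (simp add: Wp_def orthogonal_def inner_add_left)
  then show thesis using that x(1) by blast
qed

lemma diag_entry: "diag d $ i $ i = d i"
  by (simp add: diag_def)

lemma trace_diag: "trace (diag d) = (\<Sum>i\<in>UNIV. d i)"
  by (simp add: trace_def diag_entry)

lemma mat_eq_diag: "(mat c :: complex^'n^'n) = diag (\<lambda>_. c)"
  by (rule matrix_entry_eqI) (simp add: mat_def diag_def)

lemma mat_mult_vector: "mat c ** A *v v = c *s (A *v v)" for A :: "complex^'n^'n"
  unfolding matrix_vector_mul_assoc[symmetric] mat_eq_diag by (simp add: vec_eq_iff diag_vector)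

lemma trace_mat_mult: "trace (mat c ** A) = c * trace A" for A :: "complex^'n^'n"
  unfolding mat_eq_diag trace_diag_mult by (simp add: trace_def sum_distrib_left)

lemma mat_mult_commute: "A ** mat c = mat c ** (A :: complex^'n^'n)"
  unfolding mat_eq_diag by (rule matrix_entry_eqI) (simp add: diag_mult_left diag_mult_right mult.commute)

section \<open>The Lie algebra of derivations\<close>

lemma is_derivation_0: "cbilinear mu \<Longrightarrow> is_derivation mu 0"
  by (simp add: is_derivation_def cbilinear_simps)

lemma is_derivation_add: "cbilinear mu \<Longrightarrow> is_derivation mu A \<Longrightarrow> is_derivation mu B \<Longrightarrow> is_derivation mu (A + B)"
  by (simp add: is_derivation_def matrix_vector_algebra cbilinear_simps)

lemma is_derivation_diff: "cbilinear mu \<Longrightarrow> is_derivation mu A \<Longrightarrow> is_derivation mu B \<Longrightarrow> is_derivation mu (A - B)"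
  by (simp add: is_derivation_def matrix_vector_algebra cbilinear_simps)

lemma is_derivation_scaleR: "cbilinear mu \<Longrightarrow> is_derivation mu A \<Longrightarrow> is_derivation mu (r *\<^sub>R A)"
  by (simp add: is_derivation_def matrix_vector_algebra cbilinear_simps scaleR_add_right)

lemma is_derivation_mat_mult: "cbilinear mu \<Longrightarrow> is_derivation mu A \<Longrightarrow> is_derivation mu (mat c ** A)"
  by (simp add: is_derivation_def mat_mult_vector cbilinear_simps vector_add_ldistrib)

lemma is_derivation_commutator:
  assumes "cbilinear mu" "is_derivation mu A" "is_derivation mu B"
  shows "is_derivation mu (A ** B - B ** A)"
  using assms
  by (simp add: is_derivation_def matrix_vector_algebra cbilinear_simps flip: matrix_vector_mul_assoc)

lemma subspace_derivations: "cbilinear mu \<Longrightarrow> subspace {A. is_derivation mu A}"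
  by (simp add: real_vector.subspace_def is_derivation_0 is_derivation_add is_derivation_scaleR)

section \<open>The radical of the trace form\<close>

definition trace_radical :: "(complex^'n \<Rightarrow> complex^'n \<Rightarrow> complex^'n) \<Rightarrow> (complex^'n^'n) set" where
  "trace_radical mu = {A. is_derivation mu A \<and> (\<forall>B. is_derivation mu B \<longrightarrow> trace (A ** B) = 0)}"

lemma trace_scaleR: "trace (r *\<^sub>R A) = r *\<^sub>R trace (A :: complex^'n^'n)"
  by (simp add: trace_def scaleR_sum_right)

lemma trace_zero [simp]: "trace (0 :: complex^'n^'n) = 0"
  by (simp add: trace_def)

lemma subspace_trace_radical: "cbilinear mu \<Longrightarrow> subspace (trace_radical mu)"
  by (auto simp: real_vector.subspace_def trace_radical_def is_derivation_0 is_derivation_add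
      is_derivation_scaleR matrix_mul_algebra trace_add trace_scaleR)

text \<open>Invariance of the trace form: it makes the radical an ideal and moves commutators
  between the factors of a pairing.\<close>

lemma trace_commutator_mult:
  "trace ((A ** B - B ** A) ** C) = trace (A ** (B ** C - C ** B))" for A B C :: "complex^'n^'n"
  using trace_mul_sym[of B "A ** C"] by (simp add: matrix_mul_algebra trace_sub matrix_mul_assoc)

lemma trace_radical_ideal:
  assumes mu: "cbilinear mu" and "is_derivation mu A" "B \<in> trace_radical mu"
  shows "A ** B - B ** A \<in> trace_radical mu" "B ** A - A ** B \<in> trace_radical mu"
proof -
  show *: "B ** A - A ** B \<in> trace_radical mu"
    using assms unfolding trace_radical_def
    by (auto simp: trace_commutator_mult intro!: is_derivation_commutator)
  show "A ** B - B ** A \<in> trace_radical mu"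
    using subspace_neg[OF subspace_trace_radical[OF mu] *] by simp
qed

text \<open>Pairing \<open>A\<close> with its conjugate replica sees only the diagonal of
  \<open>B\<close> and gives the sum of the \<open>|d i|^2\<close>. The replica is a derivation, so
  this sum is 0.\<close>

lemma trace_radical_nilpotent:
  assumes mu: "cbilinear mu" and A: "A \<in> trace_radical mu"
  shows "nilpotent A"
proof -
  obtain P B :: "complex^'a^'a" and d r where P: "invertible P" "A = P ** B ** matrix_inv P"
    and B: "block_triangular B d r"
    by (rule jordan_decomposition[of A])
  let ?S = "P ** diag (\<lambda>i. cnj (d i)) ** matrix_inv P"
  have "is_derivation mu ?S"
    using A by (intro is_derivation_semisimple_replica[OF mu _ P B]) (simp_all add: trace_radical_def)
  then have "trace (A ** ?S) = 0" using A by (simp add: trace_radical_def)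
  also have "trace (A ** ?S) = trace (diag (\<lambda>i. cnj (d i)) ** B)"
    unfolding P(2) matrix_conjugate_mult[OF P(1)] trace_conjugate[OF P(1)] by (rule trace_mul_sym)
  also have "\<dots> = (\<Sum>i\<in>UNIV. of_real ((cmod (d i))\<^sup>2))"
    using B unfolding trace_diag_mult block_triangular_def
    by (intro sum.cong) (simp_all add: complex_norm_square mult.commute del: of_real_power)
  finally have "complex_of_real (\<Sum>i\<in>UNIV. (cmod (d i))\<^sup>2) = 0" unfolding of_real_sum by simp
  then have "(\<Sum>i\<in>UNIV. (cmod (d i))\<^sup>2) = 0" by (simp only: of_real_eq_0_iff)
  then have "d i = 0" for i by (simp add: sum_nonneg_eq_0_iff)
  then show ?thesis unfolding P(2) nilpotent_iff_eigenvalues[OF P(1) B] by simp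
qed

lemma trace_radical_flag:
  assumes mu: "cbilinear mu"
  obtains N where "flag (trace_radical mu) N \<subseteq> {0}"
proof -
  have "A ** B - B ** A \<in> trace_radical mu" if "A \<in> trace_radical mu" "B \<in> trace_radical mu" for A B
    using that by (intro trace_radical_ideal[OF mu]) (simp_all add: trace_radical_def)
  then show thesis
    using that Engel_flag[OF subspace_trace_radical[OF mu] _ trace_radical_nilpotent[OF mu]] by blast
qed

lemma complex_eqI_rotate: "Re z = Re w \<Longrightarrow> Re (\<i> * z) = Re (\<i> * w) \<Longrightarrow> z = w"
  by (simp add: complex_eq_iff)

text \<open>Representation is available for real parts. Since multiplication by \<open>\<i>\<close>
  preserves derivations, an identity of real parts for all derivations is one of complex traces;
  this serves both the radical and the conclusion.\<close>

lemma trace_represented_by_derivation: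
  assumes mu: "cbilinear mu"
  obtains A where "is_derivation mu A" "\<And>B. is_derivation mu B \<Longrightarrow> trace (A ** B) = trace B"
proof -
  let ?W = "{A. is_derivation mu A}"
  have rot: "mat \<i> ** B \<in> ?W" if "B \<in> ?W" for B
    using that by (simp add: is_derivation_mat_mult[OF mu])
  obtain A where A: "A \<in> ?W" "\<And>B. B \<in> ?W \<Longrightarrow> Re (trace (A ** B)) = Re (trace B)"
  proof (rule trace_form_represents[OF subspace_derivations[OF mu]])
    fix B
    assume B: "B \<in> ?W" and orth: "\<And>C. C \<in> ?W \<Longrightarrow> Re (trace (C ** B)) = 0"
    have "trace (C ** B) = 0" if "C \<in> ?W" for C
      using orth[OF that] orth[OF rot[OF that]]
      by (intro complex_eqI_rotate) (simp_all add: trace_mat_mult flip: matrix_mul_assoc)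
    then have "trace (B ** C) = 0" if "C \<in> ?W" for C
      using that trace_mul_sym[of B C] by simp
    then have "B \<in> trace_radical mu" using B by (simp add: trace_radical_def)
    then show "Re (trace B) = 0"
      using nilpotent_trace[OF trace_radical_nilpotent[OF mu]] by simp
  qed blast
  have "trace (A ** B) = trace B" if "B \<in> ?W" for B
  proof (rule complex_eqI_rotate)
    show "Re (trace (A ** B)) = Re (trace B)" using A(2) that by blast
    have "A ** (mat \<i> ** B) = mat \<i> ** (A ** B)"
      by (simp add: matrix_mul_assoc mat_mult_commute)
    then show "Re (\<i> * trace (A ** B)) = Re (\<i> * trace B)"
      using A(2)[OF rot[OF that]] by (simp only: trace_mat_mult)
  qed
  then show thesis using that A(1) by blast
qed

text \<open>If A represents the trace, its nilpotent part X commutes with any derivation C that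
  commutes with the semisimple part, modulo the radical; hence X and the radical span a flag that
  is shifted by X and preserved by C, so that X C is nilpotent.\<close>

lemma trace_represented_by_semisimple_derivation:
  assumes mu: "cbilinear mu"
  obtains P :: "complex^'n^'n" and d where "invertible P" "is_derivation mu (P ** diag d ** matrix_inv P)"
    "\<And>B. is_derivation mu B \<Longrightarrow> trace ((P ** diag d ** matrix_inv P) ** B) = trace B"
proof -
  obtain A where A: "is_derivation mu A" and tr: "\<And>B. is_derivation mu B \<Longrightarrow> trace (A ** B) = trace B"
    using trace_represented_by_derivation[OF mu] by blast
  obtain P B :: "complex^'n^'n" and d r where P: "invertible P" "A = P ** B ** matrix_inv P"
    and B: "block_triangular B d r"
    by (rule jordan_decomposition[of A])
  define S where "S = P ** diag d ** matrix_inv P"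
  define X where "X = A - S"
  have S: "is_derivation mu S"
    using is_derivation_semisimple_replica[OF mu A P B, of "\<lambda>x. x"] by (simp add: S_def)
  have X: "is_derivation mu X" unfolding X_def by (intro is_derivation_diff mu A S)
  have SA: "S ** A = A ** S"
  proof -
    have "diag d ** B = B ** diag d"
    proof (rule matrix_entry_eqI)
      show "(diag d ** B) $ i $ j = (B ** diag d) $ i $ j" for i j
        using B by (cases "B $ i $ j = 0") (auto simp: block_triangular_def diag_mult_left diag_mult_right)
    qed
    then show ?thesis unfolding S_def P(2) matrix_conjugate_mult[OF P(1)] by simp
  qed
  then have SX: "S ** X = X ** S" unfolding X_def by (simp add: matrix_mul_algebra)
  have "nilpotent X"
  proof -
    have "X = P ** (B - diag d) ** matrix_inv P"
      unfolding X_def S_def P(2) by (simp add: matrix_mul_algebra)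
    moreover have "block_triangular (B - diag d) (\<lambda>_. 0) r"
      using B by (auto simp: block_triangular_def diag_def)
    ultimately show ?thesis using nilpotent_iff_eigenvalues[OF P(1)] by metis
  qed
  have "trace (X ** C) = 0" if C: "is_derivation mu C" for C
  proof -
    have ss: "S ** Y - Y ** S = 0" if "S ** (S ** Y - Y ** S) - (S ** Y - Y ** S) ** S = 0" for Y
    proof (rule semisimple_ad[OF _ that])
      show "semisimple S" unfolding semisimple_def S_def using P(1) by blast
    qed
    \<comment> \<open>This splits \<open>C\<close> as \<open>Z + [S, Y]\<close> with
      \<open>Z\<close> commuting with \<open>S\<close>. The bracket pairs to 0 with \<open>X\<close>
      by invariance, since \<open>X\<close> commutes with \<open>S\<close>, so only \<open>Z\<close>
      counts.\<close>
    obtain Y where Y: "is_derivation mu Y"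
      and comm: "S ** (C - (S ** Y - Y ** S)) - (C - (S ** Y - Y ** S)) ** S = 0"
      using kernel_plus_image[OF linear_ad[of S] subspace_derivations[OF mu] _ ss, of C] C
        is_derivation_commutator[OF mu S] by (auto simp: image_subset_iff)
    define Z where "Z = C - (S ** Y - Y ** S)"
    have Z: "is_derivation mu Z"
      unfolding Z_def by (intro is_derivation_diff is_derivation_commutator mu C S Y)
    have SZ: "S ** Z = Z ** S" using comm unfolding Z_def[symmetric] by simp
    have "trace (X ** (S ** Y - Y ** S)) = 0"
      unfolding trace_commutator_mult[symmetric] using SX by simp
    then have XC: "trace (X ** C) = trace (X ** Z)"
      unfolding Z_def by (simp add: matrix_mul_algebra trace_sub)
    have AZ: "Z ** X - X ** Z = - (A ** Z - Z ** A)"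
      using SZ unfolding X_def by (simp add: matrix_mul_algebra)
    have ZX: "Z ** X - X ** Z \<in> trace_radical mu"
    proof -
      \<comment> \<open>Invariance turns this into the pairing of \<open>A\<close> with
        \<open>[Z, D]\<close>, which is the trace of a commutator because \<open>A\<close>
        represents the trace.\<close>
      have "trace ((A ** Z - Z ** A) ** D) = 0" if "is_derivation mu D" for D
        unfolding trace_commutator_mult
        using tr[OF is_derivation_commutator[OF mu Z that]] by (simp add: trace_commutator)
      then have "A ** Z - Z ** A \<in> trace_radical mu"
        by (simp add: trace_radical_def is_derivation_commutator[OF mu A Z])
      then show ?thesis unfolding AZ by (rule subspace_neg[OF subspace_trace_radical[OF mu]])
    qed
    obtain N where N: "flag (trace_radical mu) N \<subseteq> {0}" by (rule trace_radical_flag[OF mu])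
    let ?K = "{k + t *\<^sub>R X |k t. k \<in> trace_radical mu}"
    have "\<exists>N'. flag ?K N' \<subseteq> {0}"
      by (rule flag_extend[OF trace_radical_ideal(1)[OF mu X] N \<open>nilpotent X\<close>]) auto
    then obtain N' where N': "flag ?K N' \<subseteq> {0}" ..
    have XK: "X \<in> ?K"
      using subspace_0[OF subspace_trace_radical[OF mu]]
      by (intro CollectI exI[of _ 0] exI[of _ "1 :: real"] conjI) simp_all
    have normK: "Z ** k - k ** Z \<in> ?K" if "k \<in> ?K" for k
    proof -
      from that obtain l t where l: "l \<in> trace_radical mu" "k = l + t *\<^sub>R X" by blast
      have "Z ** k - k ** Z = (Z ** l - l ** Z) + t *\<^sub>R (Z ** X - X ** Z)"
        unfolding l by (simp add: matrix_mul_algebra algebra_simps)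
      also have "\<dots> \<in> trace_radical mu"
        using trace_radical_ideal(1)[OF mu Z l(1)] ZX subspace_trace_radical[OF mu]
        by (intro subspace_add subspace_scale)
      finally show ?thesis by (intro CollectI exI[of _ "Z ** k - k ** Z"] exI[of _ "0 :: real"] conjI) simp_all
    qed
    have "((*v) (X ** Z) ^^ b) v \<in> flag ?K b" for b v
    proof (induction b)
      case (Suc b)
      then show ?case
        using flag_step[OF XK flag_normalizer[OF normK]]
        by (simp add: matrix_vector_mul_assoc[symmetric] del: flag.simps)
    qed simp
    then have "nilpotent (X ** Z)" using N' unfolding nilpotent_def by blast
    then show ?thesis using XC nilpotent_trace by simp
  qed
  then have "trace (S ** C) = trace C" if "is_derivation mu C" for C
    using tr[OF that] that unfolding X_def by (simp add: matrix_mul_algebra trace_sub)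
  then show thesis using that P(1) S unfolding S_def by blast
qed

section \<open>Rationality of the eigenvalues\<close>

lemma rational_linear_functional:
  assumes "z \<notin> \<rat>"
  obtains f :: "complex \<Rightarrow> rat" where "\<And>x y. f (x + y) = f x + f y" "\<And>q x. f (of_rat q * x) = q * f x"
    "f 1 = 0" "f z = 1"
proof -
  interpret Q: vector_space_pair "\<lambda>q x. of_rat q * x :: complex" "(*) :: rat \<Rightarrow> rat \<Rightarrow> rat"
    by unfold_locales (simp_all add: algebra_simps of_rat_add of_rat_mult)
  have "z \<notin> Q.vs1.span {1}"
    using assms by (auto simp: Q.vs1.span_singleton)
  then have "Q.vs1.independent {z, 1}"
    by (simp add: Q.vs1.independent_insert)
  then obtain f where f: "Vector_Spaces.linear (\<lambda>q x. of_rat q * x) (*) f"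
    "\<And>x. x \<in> {z, 1} \<Longrightarrow> f x = (if x = z then 1 else 0)"
    using Q.linear_independent_extend[of "{z, 1}" "\<lambda>x. if x = z then 1 else 0"] by blast
  interpret f: Vector_Spaces.linear "\<lambda>q x. of_rat q * x :: complex" "(*) :: rat \<Rightarrow> rat \<Rightarrow> rat" f
    by (rule f(1))
  have "z \<noteq> 1" using assms by auto
  then show thesis
    using f(2) by (intro that[of f]) (auto simp: f.add f.scale)
qed

text \<open>For a rational functional f with f 1 = 0, the trace identity for the replica of the
  derivation with eigenvalues f (d i) gives, after applying f, that the sum of the squares of
  the f (d i) vanishes.\<close>

lemma trace_representing_eigenvalues_rational:
  fixes P :: "complex^'n^'n"
  assumes mu: "cbilinear mu" and P: "invertible P"
    and S: "is_derivation mu (P ** diag d ** matrix_inv P)"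
    and tr: "\<And>B. is_derivation mu B \<Longrightarrow> trace ((P ** diag d ** matrix_inv P) ** B) = trace B"
  shows "d i \<in> \<rat>"
proof (rule ccontr)
  assume "d i \<notin> \<rat>"
  then obtain f :: "complex \<Rightarrow> rat" where f: "\<And>x y. f (x + y) = f x + f y"
    "\<And>q x. f (of_rat q * x) = q * f x" "f 1 = 0" "f (d i) = 1"
    using rational_linear_functional by blast
  obtain r :: "'n \<Rightarrow> nat" where "inj r"
    using finite_imp_inj_to_nat_seg[of "UNIV :: 'n set"] by auto
  then have B: "block_triangular (diag d) d r"
    by (auto simp: block_triangular_def diag_def)
  let ?g = "\<lambda>j. of_rat (f (d j)) :: complex"
  have "is_derivation mu (P ** diag ?g ** matrix_inv P)"
    using is_derivation_semisimple_replica[OF mu S P refl B, of "\<lambda>x. of_rat (f x)"]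
    by (simp add: f of_rat_add)
  \<comment> \<open>The trailing \<open>* 1\<close> displays the right side as a rational multiple
    of 1, which \<open>f\<close> kills; on the left \<open>f\<close> pulls out the rational factors
    and leaves squares.\<close>
  from tr[OF this] have "(\<Sum>j\<in>UNIV. ?g j * d j) = of_rat (\<Sum>j\<in>UNIV. f (d j)) * 1"
    unfolding matrix_conjugate_mult[OF P] trace_conjugate[OF P]
    by (simp add: trace_diag_mult trace_diag of_rat_sum diag_entry mult.commute)
  then have "f (\<Sum>j\<in>UNIV. ?g j * d j) = 0" by (simp only: f(2,3) mult_zero_right)
  moreover have "f 0 = 0" using f(1)[of 0 0] by simp
  then have "f (\<Sum>j\<in>J. ?g j * d j) = (\<Sum>j\<in>J. f (d j) * f (d j))" for J
    by (induction J rule: infinite_finite_induct) (simp_all add: f)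
  ultimately have "(\<Sum>j\<in>UNIV. f (d j) * f (d j)) = 0" by simp
  then show False using f(4) by (simp add: sum_nonneg_eq_0_iff)
qed

section \<open>The moment map\<close>

definition herm :: "complex^'n \<Rightarrow> complex^'n \<Rightarrow> complex" where
  "herm u v = (\<Sum>k\<in>UNIV. u $ k * cnj (v $ k))"

lemma herm_self_eq_0: "herm v v = 0 \<longleftrightarrow> v = 0"
proof -
  have "herm v v = of_real (\<Sum>k\<in>UNIV. (cmod (v $ k))\<^sup>2)"
    unfolding herm_def of_real_sum by (intro sum.cong) (simp_all add: complex_norm_square del: of_real_power)
  then show ?thesis
    by (auto simp: sum_nonneg_eq_0_iff vec_eq_iff simp del: of_real_sum of_real_power)
qed

lemma herm_adjoint: "herm (A *v u) v = herm u (adjoint_mat A *v v)"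
proof -
  have "herm (A *v u) v = (\<Sum>k\<in>UNIV. \<Sum>j\<in>UNIV. A $ k $ j * u $ j * cnj (v $ k))"
    by (simp add: herm_def matrix_vector_mult_def sum_distrib_right)
  also have "\<dots> = (\<Sum>j\<in>UNIV. \<Sum>k\<in>UNIV. A $ k $ j * u $ j * cnj (v $ k))"
    by (rule sum.swap)
  also have "\<dots> = herm u (adjoint_mat A *v v)"
    by (simp add: herm_def matrix_vector_mult_def adjoint_mat_def sum_distrib_left mult_ac)
  finally show ?thesis .
qed

lemma herm_simps:
  "herm (c *s u) v = c * herm u v" "herm u (c *s v) = cnj c * herm u v"
  "herm (u - w) v = herm u v - herm w v" "herm u (v - w) = herm u v - herm u w" "herm u 0 = 0"
  by (simp_all add: herm_def sum_distrib_left sum_subtractf[symmetric] algebra_simps)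

lemma gen_eigenvec_eigenvector:
  "gen_eigenvec m A l v \<Longrightarrow> v \<noteq> 0 \<Longrightarrow> \<exists>w. w \<noteq> 0 \<and> A *v w = l *s w"
proof (induction m arbitrary: v)
  case (Suc m)
  show ?case
  proof (cases "A *v v - l *s v = 0")
    case True
    then show ?thesis using Suc.prems(2) by auto
  next
    case False
    then show ?thesis using Suc.IH Suc.prems(1) by simp
  qed
qed simp

text \<open>For real \<open>l\<close> and \<open>w = (A - l) v\<close> with
  \<open>A w = l w\<close>, self-adjointness gives \<open>herm w w = herm v ((A - l) w) = 0\<close>.
  So generalized eigenvectors, in particular the columns of \<open>P\<close>, are
  eigenvectors.\<close>

lemma hermitian_real_diagonalizable:
  fixes A :: "complex^'n^'n"
  assumes A: "adjoint_mat A = A"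
  obtains P :: "complex^'n^'n" and d :: "'n \<Rightarrow> real" where "invertible P"
    "A = P ** diag (\<lambda>i. of_real (d i)) ** matrix_inv P"
proof -
  obtain P B :: "complex^'n^'n" and d r where P: "invertible P" "A = P ** B ** matrix_inv P"
    and B: "block_triangular B d r"
    by (rule jordan_decomposition[of A])
  have real: "cnj l = l" if "A *v w = l *s w" "w \<noteq> 0" for l w
    using herm_adjoint[of A w w] that by (simp add: A herm_simps herm_self_eq_0)
  have step: "A *v v = l *s v" if l: "cnj l = l" and "gen_eigenvec m A l v" for l m v
    using that(2)
  proof (induction m arbitrary: v)
    case 0
    then show ?case by simp
  next
    case (Suc m)
    define w where "w = A *v v - l *s v"
    have "A *v w = l *s w" using Suc by (simp add: w_def)
    then have "herm (A *v v - l *s v) w = 0"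
      using herm_adjoint[of A v w] by (simp add: A herm_simps l)
    then show ?case by (simp add: herm_self_eq_0 flip: w_def) (simp add: w_def)
  qed
  have col: "gen_eigenvec (Suc (r i)) A (d i) (P *v axis i 1)" for i
    unfolding P(2) gen_eigenvec_conjugate[OF P(1)] matrix_vector_inv_left[OF P(1)]
    by (intro block_triangular_gen_eigenvec[OF B]) (auto simp: axis_def split: if_splits)
  have "P *v axis i 1 \<noteq> 0" for i
    using matrix_vector_inv_left[OF P(1), of "axis i 1"] by (auto simp: axis_eq_0_iff)
  then have d: "cnj (d i) = d i" for i
    using gen_eigenvec_eigenvector[OF col] real by metis
  have "A ** P *v axis i 1 = P ** diag d *v axis i 1" for i
  proof -
    have "diag d *v axis i 1 = d i *s axis i 1" by (simp add: vec_eq_iff diag_vector axis_def)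
    then show ?thesis
      using step[OF d col, of i] by (simp add: matrix_vector_mult_smult flip: matrix_vector_mul_assoc)
  qed
  then have "A ** P = P ** diag d"
    by (rule matrix_eqI_axis)
  then have "A ** (P ** matrix_inv P) = P ** diag d ** matrix_inv P"
    by (simp add: matrix_mul_assoc)
  moreover have "d = (\<lambda>i. of_real (Re (d i)))"
    using d by (auto simp: complex_eq_iff)
  ultimately show thesis
    using that[of P "\<lambda>i. Re (d i)"] P(1) by (simp add: matrix_inv_right)
qed

section \<open>Pairing the moment map with derivations\<close>

definition frobenius :: "complex^'n^'n \<Rightarrow> complex^'n^'n \<Rightarrow> complex" where
  "frobenius A B = trace (A ** adjoint_mat B)"

lemma frobenius_sum: "frobenius A B = (\<Sum>j\<in>UNIV. \<Sum>k\<in>UNIV. A $ k $ j * cnj (B $ k $ j))"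
  unfolding frobenius_def trace_def by (subst sum.swap) (simp add: matrix_matrix_mult_def adjoint_mat_def)

lemma frobenius_self: "frobenius A A = of_real (\<Sum>j\<in>UNIV. \<Sum>k\<in>UNIV. (cmod (A $ k $ j))\<^sup>2)"
  unfolding frobenius_sum of_real_sum
  by (intro sum.cong) (simp_all add: complex_norm_square del: of_real_power)

lemma sum_frobenius_self_eq_0:
  fixes F :: "'n \<Rightarrow> complex^'n^'n"
  assumes "(\<Sum>i\<in>UNIV. frobenius (F i) (F i)) = 0"
  shows "F i $ k $ j = 0"
  using assms unfolding frobenius_self of_real_sum[symmetric] of_real_eq_0_iff
  by (simp add: sum_nonneg_eq_0_iff sum_nonneg)

lemma adjoint_mat_mult: "adjoint_mat (A ** B) = adjoint_mat B ** adjoint_mat A"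
  by (rule matrix_entry_eqI) (simp add: adjoint_mat_def matrix_matrix_mult_def mult.commute)

lemma adjoint_mat_adjoint [simp]: "adjoint_mat (adjoint_mat A) = A"
  by (rule matrix_entry_eqI) (simp add: adjoint_mat_def)

lemma adjoint_mat_M: "adjoint_mat (M_mat mu) = M_mat mu"
proof -
  have "adjoint_mat (A - B) = adjoint_mat A - adjoint_mat B" "adjoint_mat (r *\<^sub>R A) = r *\<^sub>R adjoint_mat A"
    for A B :: "complex^'a^'a" and r
    by (rule matrix_entry_eqI, simp add: adjoint_mat_def)+
  moreover have "adjoint_mat (\<Sum>i\<in>UNIV. F i) = (\<Sum>i\<in>UNIV. adjoint_mat (F i))" for F :: "'a \<Rightarrow> complex^'a^'a"
    by (rule matrix_entry_eqI) (simp add: adjoint_mat_def)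
  ultimately show ?thesis by (simp add: M_mat_def adjoint_mat_mult)
qed

text \<open>With the action \<open>(A.mu)(x, y) = A mu(x, y) - mu(A x, y) - mu(x, A y)\<close>, the
  right side is twice the Hermitian pairing of \<open>A.mu\<close> with \<open>mu\<close>: the
  moment map property.\<close>

lemma trace_M_mult:
  fixes A :: "complex^'n^'n"
  shows
  "trace (M_mat mu ** A) = 2 * ((\<Sum>i\<in>UNIV. frobenius (A ** Lmat mu (axis i 1)) (Lmat mu (axis i 1)))
     - (\<Sum>i\<in>UNIV. frobenius (Lmat mu (axis i 1) ** A) (Lmat mu (axis i 1)))
     - (\<Sum>i\<in>UNIV. frobenius (Rmat mu (axis i 1) ** A) (Rmat mu (axis i 1))))"
proof -
  have tr_sum: "trace ((\<Sum>i\<in>UNIV. F i) ** A) = (\<Sum>i\<in>UNIV. trace (F i ** A))" for F :: "'n \<Rightarrow> complex^'n^'n"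
  proof -
    have "(\<Sum>i\<in>UNIV. F i) ** A = (\<Sum>i\<in>UNIV. F i ** A)"
      by (intro linear_sum[of "\<lambda>X. X ** A"]
        bilinear_matrix_mul[unfolded bilinear_def, THEN conjunct2, THEN spec])
    moreover have "trace (\<Sum>i\<in>UNIV. G i) = (\<Sum>i\<in>UNIV. trace (G i))" for G :: "'n \<Rightarrow> complex^'n^'n"
      unfolding trace_def by (subst sum.swap) simp
    ultimately show ?thesis by simp
  qed
  have 1: "trace (L ** adjoint_mat L ** A) = frobenius (A ** L) L" for L
    unfolding frobenius_def using trace_mul_sym[of "L ** adjoint_mat L" A] by (simp add: matrix_mul_assoc)
  have 2: "trace (adjoint_mat L ** L ** A) = frobenius (L ** A) L" for L
    unfolding frobenius_def using trace_mul_sym[of "adjoint_mat L" "L ** A"] by (simp add: matrix_mul_assoc)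
  show ?thesis
    unfolding M_mat_def matrix_mul_algebra trace_sub trace_scaleR tr_sum 1 2
    by (simp add: scaleR_conv_of_real algebra_simps)
qed

lemma cbilinear_sum_axis:
  assumes mu: "cbilinear mu"
  shows "mu x y = (\<Sum>j\<in>UNIV. y $ j *s mu x (axis j 1))" "mu y x = (\<Sum>j\<in>UNIV. y $ j *s mu (axis j 1) x)"
proof -
  have *: "mu x (\<Sum>j\<in>J. y $ j *s axis j 1) = (\<Sum>j\<in>J. y $ j *s mu x (axis j 1))"
    "mu (\<Sum>j\<in>J. y $ j *s axis j 1) x = (\<Sum>j\<in>J. y $ j *s mu (axis j 1) x)" for J
    by (induction J rule: infinite_finite_induct) (simp_all add: cbilinear_simps[OF mu])
  show "mu x y = (\<Sum>j\<in>UNIV. y $ j *s mu x (axis j 1))" "mu y x = (\<Sum>j\<in>UNIV. y $ j *s mu (axis j 1) x)"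
    using *[of UNIV] by (simp_all add: basis_expansion)
qed

lemma Lmat_mult_vector: "cbilinear mu \<Longrightarrow> Lmat mu x *v y = mu x y"
  by (subst cbilinear_sum_axis(1)) (simp_all add: Lmat_def matrix_vector_mult_def vec_eq_iff mult.commute)

lemma Rmat_mult_vector: "cbilinear mu \<Longrightarrow> Rmat mu x *v y = mu y x"
  by (subst cbilinear_sum_axis(2)) (simp_all add: Rmat_def matrix_vector_mult_def vec_eq_iff mult.commute)

lemma trace_M_derivation:
  assumes mu: "cbilinear mu" and A: "is_derivation mu A"
  shows "trace (M_mat mu ** A) = 0"
proof -
  have L: "A ** Lmat mu x = Lmat mu (A *v x) + Lmat mu x ** A" for x
    using A by (intro matrix_eqI)
      (simp add: matrix_vector_algebra Lmat_mult_vector[OF mu] is_derivation_def flip: matrix_vector_mul_assoc)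
  have add: "frobenius (X + Y) Z = frobenius X Z + frobenius Y Z" for X Y Z :: "complex^'a^'a"
    by (simp add: frobenius_def matrix_mul_algebra trace_add)
  have R: "(Rmat mu x ** A) $ k $ i = mu (A *v axis i 1) x $ k" for x k i
    using arg_cong[OF matrix_vector_axis[of "Rmat mu x ** A" i], of "\<lambda>v. v $ k"]
    by (simp add: column_def Rmat_mult_vector[OF mu] flip: matrix_vector_mul_assoc)
  \<comment> \<open>Both sides sum \<open>mu (A e_i) e_j\<close> against \<open>mu e_i e_j\<close>;
    only the order of summation differs.\<close>
  have "(\<Sum>i\<in>UNIV. frobenius (Lmat mu (A *v axis i 1)) (Lmat mu (axis i 1))) =
      (\<Sum>j\<in>UNIV. frobenius (Rmat mu (axis j 1) ** A) (Rmat mu (axis j 1)))"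
    unfolding frobenius_sum R by (subst sum.swap) (simp add: Lmat_def Rmat_def)
  then show ?thesis unfolding trace_M_mult L add by (simp add: sum.distrib)
qed

text \<open>For \<open>A = mat 1\<close> the two sums over left multiplications cancel, so the trace
  is -2 times the squared norm of \<open>mu\<close>.\<close>

lemma trace_M_eq_0:
  assumes mu: "cbilinear mu" and "trace (M_mat mu) = 0"
  shows "mu x y = 0"
proof -
  have "(\<Sum>i\<in>UNIV. frobenius (Rmat mu (axis i 1)) (Rmat mu (axis i 1))) = 0"
    using trace_M_mult[of mu "mat 1"] assms(2) by simp
  from sum_frobenius_self_eq_0[OF this] have "mu (axis j 1) (axis i 1) = 0" for i j
    by (simp add: Rmat_def vec_eq_iff)
  then have "mu x (axis i 1) = 0" for i
    using cbilinear_sum_axis(2)[OF mu, of x "axis i 1"] by simp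
  then show ?thesis using cbilinear_sum_axis(1)[OF mu, of x y] by simp
qed

text \<open>\<open>c = 0\<close> would make the Hermitian \<open>M_mat mu\<close> a derivation,
  hence orthogonal to itself, hence zero, and then its trace forces \<open>mu = 0\<close>. Otherwise
  pairing with a derivation \<open>psi\<close> gives \<open>0 = c trace psi + trace (D psi)\<close>.
  \<open>D\<close> is Hermitian because \<open>c\<close> is real.\<close>

lemma critical_point_nikolayevsky:
  assumes mu: "cbilinear mu" and "mu x y \<noteq> 0" and D: "is_derivation mu D"
    and M: "M_mat mu = mat (complex_of_real c) + D"
  shows "nikolayevsky_derivation mu (mat (complex_of_real (- 1 / c)) ** D)"
proof -
  have "c \<noteq> 0"
  proof
    assume "c = 0"
    then have "M_mat mu = D" using M by (simp add: mat_0)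
    then have "frobenius (M_mat mu) (M_mat mu) = 0"
      using trace_M_derivation[OF mu D] unfolding frobenius_def adjoint_mat_M by simp
    then have "(\<Sum>i\<in>(UNIV :: 'a set). frobenius (M_mat mu) (M_mat mu)) = 0" by simp
    then have "M_mat mu $ k $ j = 0" for k j by (rule sum_frobenius_self_eq_0)
    then have "trace (M_mat mu) = 0" by (simp add: trace_def)
    then show False using trace_M_eq_0[OF mu] assms(2) by blast
  qed
  have Dc: "D = M_mat mu - mat (complex_of_real c)" using M by simp
  have "adjoint_mat D = D"
  proof (rule matrix_entry_eqI)
    fix i j
    have "cnj (M_mat mu $ j $ i) = M_mat mu $ i $ j"
      using arg_cong[OF adjoint_mat_M[of mu], of "\<lambda>X. X $ i $ j"] by (simp add: adjoint_mat_def)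
    then show "adjoint_mat D $ i $ j = D $ i $ j"
      unfolding Dc by (simp add: adjoint_mat_def mat_def)
  qed
  then obtain P :: "complex^'a^'a" and d :: "'a \<Rightarrow> real" where P: "invertible P"
    and DP: "D = P ** diag (\<lambda>i. of_real (d i)) ** matrix_inv P"
    by (rule hermitian_real_diagonalizable)
  let ?s = "complex_of_real (- 1 / c)"
  have "mat ?s ** D = P ** (mat ?s ** diag (\<lambda>i. of_real (d i))) ** matrix_inv P"
    unfolding DP by (simp add: matrix_mul_assoc mat_mult_commute)
  also have "mat ?s ** diag (\<lambda>i. of_real (d i)) = diag (\<lambda>i. of_real (- 1 / c * d i))"
    unfolding mat_eq_diag by (rule matrix_entry_eqI) (simp add: diag_mult_left, simp add: diag_def)
  finally have "real_diagonalizable (mat ?s ** D)"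
    unfolding real_diagonalizable_def diag_def
    using P by (intro exI[of _ P] exI[of _ "\<lambda>i. - 1 / c * d i"] conjI)
  moreover have "trace (mat ?s ** D ** psi) = trace psi" if "is_derivation mu psi" for psi
  proof -
    have "complex_of_real c * trace psi + trace (D ** psi) = 0"
      using trace_M_derivation[OF mu that] unfolding M by (simp add: matrix_mul_algebra trace_add trace_mat_mult)
    then have "trace (D ** psi) = - complex_of_real c * trace psi" by (simp add: add_eq_0_iff)
    then show ?thesis
      using \<open>c \<noteq> 0\<close> unfolding matrix_mul_assoc[symmetric] trace_mat_mult by simp
  qed
  ultimately show ?thesis
    unfolding nikolayevsky_derivation_def using is_derivation_mat_mult[OF mu D] by blast
qed

section \<open>Conjugacy\<close>

lemma automorphism_inverse:
  assumes g: "is_automorphism mu g" and gh: "g ** h = mat 1" "h ** g = mat 1"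
  shows "is_automorphism mu h"
proof -
  have "h *v mu x y = mu (h *v x) (h *v y)" for x y
  proof -
    have "g *v mu (h *v x) (h *v y) = mu x y"
      using g gh by (simp add: is_automorphism_def matrix_vector_mul_assoc)
    then have "h *v (g *v mu (h *v x) (h *v y)) = h *v mu x y" by simp
    then show ?thesis using gh by (simp add: matrix_vector_mul_assoc)
  qed
  then show ?thesis using gh unfolding is_automorphism_def invertible_def by blast
qed

lemma automorphism_mult:
  "is_automorphism mu g \<Longrightarrow> is_automorphism mu h \<Longrightarrow> is_automorphism mu (g ** h)"
  unfolding is_automorphism_def by (auto simp: invertible_mult simp flip: matrix_vector_mul_assoc)

lemma is_derivation_conjugate:
  assumes g: "is_automorphism mu g" and gh: "g ** h = mat 1" "h ** g = mat 1" and D: "is_derivation mu D"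
    and mu: "cbilinear mu"
  shows "is_derivation mu (g ** D ** h)"
proof -
  have h: "is_automorphism mu h" by (rule automorphism_inverse[OF g gh])
  have gh': "g *v (h *v x) = x" for x using gh by (simp add: matrix_vector_mul_assoc)
  show ?thesis
    using g h D unfolding is_automorphism_def is_derivation_def
    by (simp add: matrix_vector_algebra gh' flip: matrix_vector_mul_assoc)
qed

section \<open>Exponentials of nilpotent derivations\<close>

primrec mpow :: "complex^'n^'n \<Rightarrow> nat \<Rightarrow> complex^'n^'n" where
  "mpow A 0 = mat 1"
| "mpow A (Suc k) = A ** mpow A k"

lemma mpow_vector: "mpow A k *v v = ((*v) A ^^ k) v"
  by (induction k) (simp_all flip: matrix_vector_mul_assoc)

text \<open>The cut-off series is the full exponential once \<open>A^M = 0\<close>, so no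
  convergence is involved.\<close>

definition mexp :: "nat \<Rightarrow> complex^'n^'n \<Rightarrow> complex^'n^'n" where
  "mexp M A = (\<Sum>k<M. (1 / fact k) *\<^sub>R mpow A k)"

lemma matrix_vector_sum_left: "(\<Sum>i\<in>I. F i) *v v = (\<Sum>i\<in>I. F i *v v)" for F :: "_ \<Rightarrow> complex^'n^'n"
  by (induction I rule: infinite_finite_induct) (simp_all add: matrix_vector_algebra)

text \<open>Dividing by factorials removes the binomial coefficients: \<open>D\<close> takes
  \<open>t k\<close> to \<open>(k + 1) t (k + 1)\<close>, and the term with index \<open>i\<close>
  arises with factors \<open>i\<close> and \<open>m + 1 - i\<close>, which add up to
  \<open>m + 1\<close>.\<close>

lemma divided_power_Leibniz:
  assumes mu: "cbilinear mu" and D: "is_derivation mu D"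
  defines "t \<equiv> \<lambda>k v. (1 / fact k) *\<^sub>R ((*v) D ^^ k) v"
  shows "t m (mu a b) = (\<Sum>i\<le>m. mu (t i a) (t (m - i) b))"
proof (induction m)
  case 0
  then show ?case by (simp add: t_def)
next
  case (Suc m)
  have t: "D *v t k v = real (Suc k) *\<^sub>R t (Suc k) v" for k v
    by (simp add: t_def matrix_vector_algebra del: of_nat_Suc)
  let ?s = "\<lambda>i. mu (t i a) (t (Suc m - i) b)"
  have D_sum: "D *v (\<Sum>i\<in>I. f i) = (\<Sum>i\<in>I. D *v f i)" for f :: "nat \<Rightarrow> complex^'a" and I
    by (induction I rule: infinite_finite_induct) (simp_all add: matrix_vector_algebra)
  have "real (Suc m) *\<^sub>R t (Suc m) (mu a b) = (\<Sum>i\<le>m. D *v mu (t i a) (t (m - i) b))"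
    unfolding t[symmetric] Suc D_sum ..
  also have "\<dots> = (\<Sum>i\<le>m. real (Suc i) *\<^sub>R ?s (Suc i) + real (Suc m - i) *\<^sub>R ?s i)"
  proof (intro sum.cong refl)
    fix i
    assume "i \<in> {..m}"
    then have "Suc m - i = Suc (m - i)" by auto
    then show "D *v mu (t i a) (t (m - i) b) = real (Suc i) *\<^sub>R ?s (Suc i) + real (Suc m - i) *\<^sub>R ?s i"
      using D by (simp add: is_derivation_def t cbilinear_simps[OF mu] del: of_nat_Suc)
  qed
  also have "\<dots> = (\<Sum>i\<le>Suc m. real i *\<^sub>R ?s i) + (\<Sum>i\<le>Suc m. real (Suc m - i) *\<^sub>R ?s i)"
  proof -
    have "(\<Sum>i\<le>Suc m. real i *\<^sub>R ?s i) = (\<Sum>i\<le>m. real (Suc i) *\<^sub>R ?s (Suc i))"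
      by (subst sum.atMost_Suc_shift) simp
    moreover have "(\<Sum>i\<le>Suc m. real (Suc m - i) *\<^sub>R ?s i) = (\<Sum>i\<le>m. real (Suc m - i) *\<^sub>R ?s i)"
      by simp
    ultimately show ?thesis by (simp only: sum.distrib)
  qed
  also have "\<dots> = (\<Sum>i\<le>Suc m. real (Suc m) *\<^sub>R ?s i)"
    unfolding sum.distrib[symmetric]
    by (intro sum.cong refl) (simp add: scaleR_add_left[symmetric] of_nat_diff del: of_nat_Suc)
  also have "\<dots> = real (Suc m) *\<^sub>R (\<Sum>i\<le>Suc m. ?s i)" by (rule scaleR_sum_right[symmetric])
  finally show ?case by (simp only: scaleR_cancel_left of_nat_eq_0_iff) simp
qed

lemma mexp_multiplicative:
  assumes mu: "cbilinear mu" and D: "is_derivation mu D" and nil: "\<And>v. ((*v) D ^^ M) v = 0"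
  shows "mexp M D *v mu a b = mu (mexp M D *v a) (mexp M D *v b)"
proof -
  define t where "t = (\<lambda>k v. (1 / fact k) *\<^sub>R ((*v) D ^^ k) v)"
  have "((*v) D ^^ k) v = 0" if "M \<le> k" for k v
  proof -
    have "((*v) D ^^ k) v = ((*v) D ^^ M) (((*v) D ^^ (k - M)) v)"
      using that by (metis comp_apply funpow_add le_add_diff_inverse)
    then show ?thesis using nil by simp
  qed
  then have t0: "t k v = 0" if "M \<le> k" for k v using that by (simp add: t_def)
  have exp: "mexp M D *v v = (\<Sum>k<M. t k v)" for v
    by (simp add: mexp_def matrix_vector_sum_left matrix_vector_algebra mpow_vector t_def)
  have sum1: "mu (\<Sum>i\<in>I. f i) y = (\<Sum>i\<in>I. mu (f i) y)" and sum2: "mu y (\<Sum>i\<in>I. f i) = (\<Sum>i\<in>I. mu y (f i))"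
    for I :: "nat set" and f y
    by (induction I rule: infinite_finite_induct) (simp_all add: cbilinear_simps[OF mu])
  \<comment> \<open>The bound \<open>2 * M\<close> makes the triangle of index pairs contain the
    square of side \<open>M\<close>; outside the square one factor vanishes.\<close>
  have "mexp M D *v mu a b = (\<Sum>k<2 * M. t k (mu a b))"
    unfolding exp by (intro sum.mono_neutral_left) (auto simp: t0)
  also have "\<dots> = (\<Sum>k<2 * M. \<Sum>i\<le>k. mu (t i a) (t (k - i) b))"
    using divided_power_Leibniz[OF mu D] by (simp add: t_def)
  also have "\<dots> = (\<Sum>(i, j)\<in>{(i, j). i + j < 2 * M}. mu (t i a) (t j b))"
    by (rule sum.triangle_reindex[symmetric])
  also have "\<dots> = (\<Sum>(i, j)\<in>{..<M} \<times> {..<M}. mu (t i a) (t j b))"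
  proof (rule sum.mono_neutral_right)
    have "{(i, j). i + j < 2 * M} \<subseteq> {..<2 * M} \<times> {..<2 * M}" by auto
    then show "finite {(i, j). i + j < 2 * M}" by (rule finite_subset) simp
    show "\<forall>p\<in>{(i, j). i + j < 2 * M} - {..<M} \<times> {..<M}. (case p of (i, j) \<Rightarrow> mu (t i a) (t j b)) = 0"
    proof
      fix p
      assume p: "p \<in> {(i, j). i + j < 2 * M} - {..<M} \<times> {..<M}"
      obtain i j where ij: "p = (i, j)" by force
      then have "M \<le> i \<or> M \<le> j" using p by auto
      then show "(case p of (i, j) \<Rightarrow> mu (t i a) (t j b)) = 0"
        by (auto simp: ij t0 cbilinear_simps[OF mu])
    qed
  qed auto
  also have "\<dots> = mu (mexp M D *v a) (mexp M D *v b)"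
    unfolding exp unfolding sum1 unfolding sum2 by (rule sum.cartesian_product[symmetric])
  finally show ?thesis .
qed

section \<open>Filtration of matrices by flag shift\<close>

definition flag_shift :: "(complex^'n^'n) set \<Rightarrow> nat \<Rightarrow> (complex^'n^'n) set" where
  "flag_shift K k = {Z. \<forall>b. \<forall>v\<in>flag K b. Z *v v \<in> flag K (b + k)}"

lemma flag_shiftD: "Z \<in> flag_shift K k \<Longrightarrow> v \<in> flag K b \<Longrightarrow> Z *v v \<in> flag K (b + k)"
  by (simp add: flag_shift_def)

lemma subspace_flag_shift: "subspace (flag_shift K k)"
  using subspace_flag
  by (auto simp: flag_shift_def real_vector.subspace_def matrix_vector_algebra)

text \<open>These subspaces filter the matrix algebra: elements of \<open>K\<close> have degree 1,
  normalizers of \<open>K\<close> degree 0, and degrees beyond the length of the flag contain only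
  0.\<close>

lemma flag_shift_mult: "X \<in> flag_shift K j \<Longrightarrow> Y \<in> flag_shift K k \<Longrightarrow> X ** Y \<in> flag_shift K (j + k)"
  unfolding flag_shift_def mem_Collect_eq
  by (metis add.assoc add.commute matrix_vector_mul_assoc)

lemma flag_shift_antimono: "j \<le> k \<Longrightarrow> flag_shift K k \<subseteq> flag_shift K j"
proof
  fix Z
  assume *: "j \<le> k" "Z \<in> flag_shift K k"
  have "Z *v v \<in> flag K (b + j)" if "v \<in> flag K b" for b v
    by (rule subsetD[OF flag_antimono flag_shiftD[OF *(2) that]]) (use *(1) in simp)
  then show "Z \<in> flag_shift K j" by (simp add: flag_shift_def)
qed

lemma flag_shift_subset: "K \<subseteq> flag_shift K 1"
  using flag_step by (fastforce simp: flag_shift_def)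

lemma flag_shift_normalizer: "(\<And>k. k \<in> K \<Longrightarrow> y ** k - k ** y \<in> K) \<Longrightarrow> y \<in> flag_shift K 0"
  using flag_normalizer[of K y] by (simp add: flag_shift_def)

lemma flag_shift_eq_0: "flag K N \<subseteq> {0} \<Longrightarrow> N \<le> k \<Longrightarrow> Z \<in> flag_shift K k \<Longrightarrow> Z = 0"
proof (rule matrix_eqI)
  fix v
  assume *: "flag K N \<subseteq> {0}" "N \<le> k" "Z \<in> flag_shift K k"
  have "Z *v v \<in> flag K (0 + k)" using *(3) by (rule flag_shiftD) simp
  then show "Z *v v = 0 *v v" using * flag_antimono[of N "0 + k" K] by auto
qed

lemma mpow_flag_shift: "X \<in> flag_shift K j \<Longrightarrow> mpow X k \<in> flag_shift K (k * j)"
proof (induction k)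
  case 0
  then show ?case by (simp add: flag_shift_def)
next
  case (Suc k)
  then show ?case using flag_shift_mult[of X K j "mpow X k" "k * j"] by simp
qed

text \<open>Neumann series: the power after the \<open>N\<close>-th has degree
  \<open>(N + 1) k\<close>, past the end of the flag. The point is that the inverse differs from 1
  by an element of the same degree as \<open>u\<close>.\<close>

lemma flag_unipotent_inverse:
  assumes N: "flag K N \<subseteq> {0}" and u: "u \<in> flag_shift K k" "1 \<le> k"
  obtains e where "e \<in> flag_shift K k" "(mat 1 + u) ** (mat 1 + e) = mat 1" "(mat 1 + e) ** (mat 1 + u) = mat 1"
proof -
  have mu: "- u \<in> flag_shift K k" by (rule subspace_neg[OF subspace_flag_shift u(1)])
  define e where "e = (\<Sum>j\<in>{1..<Suc N}. mpow (- u) j)"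
  have e: "e \<in> flag_shift K k"
    unfolding e_def
  proof (rule subspace_sum[OF subspace_flag_shift])
    fix j
    assume "j \<in> {1..<Suc N}"
    then have "k \<le> j * k" by auto
    then show "mpow (- u) j \<in> flag_shift K k"
      using mpow_flag_shift[OF mu, of j] flag_shift_antimono by blast
  qed
  define S where "S n = (\<Sum>j\<in>{1..<Suc n}. mpow (- u) j)" for n
  have S: "S (Suc n) = S n + mpow (- u) (Suc n)" for n by (simp add: S_def)
  have tel: "(mat 1 + u) ** (mat 1 + S n) = mat 1 - mpow (- u) (Suc n)" for n
  proof (induction n)
    case 0
    then show ?case by (simp add: S_def matrix_mul_algebra)
  next
    case (Suc n)
    have "(mat 1 + u) ** (mat 1 + S (Suc n)) =
        (mat 1 + u) ** (mat 1 + S n) + (mat 1 + u) ** mpow (- u) (Suc n)"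
      unfolding S by (simp add: matrix_mul_algebra)
    also have "\<dots> = mat 1 - mpow (- u) (Suc (Suc n))"
      unfolding Suc.IH by (simp add: matrix_mul_algebra)
    finally show ?case .
  qed
  have "N \<le> Suc N * k" using u(2) by (simp add: trans_le_add2)
  then have "mpow (- u) (Suc N) = 0"
    using flag_shift_eq_0[OF N] mpow_flag_shift[OF mu, of "Suc N"] by blast
  then have "(mat 1 + u) ** (mat 1 + e) = mat 1" using tel[of N] unfolding e_def S_def by simp
  then show thesis using that e matrix_left_right_inverse by blast
qed

text \<open>Powers from the square on have degree at least \<open>2 * k\<close>, which exceeds
  \<open>k\<close>.\<close>

lemma mexp_flag_shift:
  assumes y: "y \<in> flag_shift K k" "1 \<le> k" and M: "2 \<le> M"
  shows "mexp M y - mat 1 - y \<in> flag_shift K (Suc k)"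
proof -
  have "{..<M} = {0, 1} \<union> {2..<M}" using M by auto
  then have "mexp M y = (\<Sum>j\<in>{0, 1}. (1 / fact j) *\<^sub>R mpow y j) + (\<Sum>j\<in>{2..<M}. (1 / fact j) *\<^sub>R mpow y j)"
    unfolding mexp_def by (simp only:) (subst sum.union_disjoint, auto)
  then have "mexp M y - mat 1 - y = (\<Sum>j\<in>{2..<M}. (1 / fact j) *\<^sub>R mpow y j)" by simp
  also have "\<dots> \<in> flag_shift K (Suc k)"
  proof (intro subspace_sum subspace_scale subspace_flag_shift)
    fix j
    assume "j \<in> {2..<M}"
    then have "2 * k \<le> j * k" by simp
    then have "Suc k \<le> j * k" using y(2) by linarith
    then show "mpow y j \<in> flag_shift K (Suc k)"
      using mpow_flag_shift[OF y(1), of j] flag_shift_antimono by blast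
  qed
  finally show ?thesis .
qed

section \<open>Uniqueness of the semisimple part\<close>

lemma semisimple_gen_eigenvec:
  assumes "semisimple A" "gen_eigenvec m A l v"
  shows "A *v v = l *s v"
proof -
  obtain P :: "complex^'a^'a" and d where P: "invertible P" and A: "A = P ** diag d ** matrix_inv P"
    using assms(1) unfolding semisimple_def by blast
  obtain r :: "'a \<Rightarrow> nat" where "inj r"
    using finite_imp_inj_to_nat_seg[of "UNIV :: 'a set"] by auto
  then have B: "block_triangular (diag d) d r"
    by (auto simp: block_triangular_def diag_def)
  let ?c = "matrix_inv P *v v"
  have "gen_eigenvec m (diag d) l ?c"
    using assms(2) unfolding A gen_eigenvec_conjugate[OF P] .
  then have "d i = l \<or> ?c $ i = 0" for i
    using block_triangular_gen_eigenvec_support[OF B] by blast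
  then have "diag d *v ?c = l *s ?c"
    unfolding vec_eq_iff diag_vector by (metis mult_zero_right vector_smult_component)
  then show ?thesis
    unfolding A by (simp add: matrix_vector_mult_smult matrix_vector_inv_right[OF P] flip: matrix_vector_mul_assoc)
qed

text \<open>On the eigenspace of \<open>A\<close> for \<open>l\<close>, \<open>B - l\<close> acts as
  \<open>-(A - B)\<close>, which preserves that space and is nilpotent. Its vectors are thus
  generalized eigenvectors of the semisimple \<open>B\<close>, hence eigenvectors, and
  \<open>A\<close> and \<open>B\<close> agree on an eigenbasis of \<open>A\<close>.\<close>

lemma semisimple_eqI:
  assumes A: "semisimple A" and B: "semisimple B" and comm: "A ** B = B ** A" and nil: "nilpotent (A - B)"
  shows "A = B"
proof -
  obtain m where m: "\<And>v. ((*v) (A - B) ^^ m) v = 0" using nil by (auto simp: nilpotent_def)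
  have gen: "gen_eigenvec j B l w" if "A *v w = l *s w" "((*v) (A - B) ^^ j) w = 0" for j l w
    using that
  proof (induction j arbitrary: w)
    case 0
    then show ?case by simp
  next
    case (Suc j)
    have w: "B *v w - l *s w = - ((A - B) *v w)" using Suc.prems(1) by (simp add: matrix_vector_algebra)
    have "A *v ((A - B) *v w) = (A - B) *v (A *v w)"
      using comm by (simp add: matrix_vector_mul_assoc matrix_mul_algebra)
    then have "A *v (- ((A - B) *v w)) = l *s (- ((A - B) *v w))"
      using Suc.prems(1) by (simp add: matrix_vector_mult_smult linear_neg[OF linear_matrix_vector])
    moreover have "((*v) (A - B) ^^ j) (- ((A - B) *v w)) = 0"
      using Suc.prems(2) linear_neg[OF linear_matrix_vector_funpow[of j "A - B"], of "(A - B) *v w"]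
      by (simp add: funpow_swap1)
    ultimately show ?case unfolding gen_eigenvec.simps w by (rule Suc.IH)
  qed
  obtain P :: "complex^'a^'a" and d where P: "invertible P" and AP: "A = P ** diag d ** matrix_inv P"
    using A unfolding semisimple_def by blast
  have "A *v (P *v axis i 1) = d i *s (P *v axis i 1)" for i
  proof -
    have "diag d *v axis i 1 = d i *s axis i 1" by (simp add: vec_eq_iff diag_vector axis_def)
    then show ?thesis
      unfolding AP by (simp add: matrix_vector_mult_smult matrix_vector_inv_left[OF P] flip: matrix_vector_mul_assoc)
  qed
  then have "A *v (P *v axis i 1) = B *v (P *v axis i 1)" for i
    using semisimple_gen_eigenvec[OF B gen[OF _ m]] by metis
  then have "A ** P = B ** P"
    by (intro matrix_eqI_axis) (simp flip: matrix_vector_mul_assoc)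
  then have "A ** (P ** matrix_inv P) = B ** (P ** matrix_inv P)" by (simp add: matrix_mul_assoc)
  then show ?thesis by (simp add: matrix_inv_right[OF P])
qed

text \<open>Downward induction on k: if A' = A + Z + X with Z in the radical commuting with A and X in
  the radical shifting its flag by k, write X = Z' + [A, Y]; conjugation by exp Y replaces
  Z + X by Z + Z' up to a term shifting the flag by k + 1.\<close>

lemma trace_representing_conjugate_aux:
  assumes mu: "cbilinear mu" and N: "flag (trace_radical mu) N \<subseteq> {0}"
    and A: "is_derivation mu A" "semisimple A" "\<And>B. is_derivation mu B \<Longrightarrow> trace (A ** B) = trace B"
    and A': "is_derivation mu A'" "semisimple A'" "\<And>B. is_derivation mu B \<Longrightarrow> trace (A' ** B) = trace B"
    and ZX: "A' = A + Z + X" and Z: "Z \<in> trace_radical mu" "A ** Z = Z ** A"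
    and X: "X \<in> trace_radical mu" "X \<in> flag_shift (trace_radical mu) k" and k: "1 \<le> k"
  shows "\<exists>g. is_automorphism mu g \<and> A' ** g = g ** A"
  using A' ZX Z X k
proof (induction "N - k" arbitrary: k A' Z X)
  case 0
  \<comment> \<open>Here \<open>k\<close> is past the end of the flag, and \<open>A'\<close> and
    \<open>A\<close> are commuting semisimple matrices with nilpotent difference.\<close>
  then have "X = 0" using flag_shift_eq_0[OF N] by (metis diff_is_0_eq)
  then have A': "A' - A = Z" using 0 by simp
  have "A' = A"
  proof (rule semisimple_eqI[OF \<open>semisimple A'\<close> A(2)])
    show "A' ** A = A ** A'" using 0 \<open>X = 0\<close> by (simp add: matrix_mul_algebra)
    show "nilpotent (A' - A)" unfolding A' by (rule trace_radical_nilpotent[OF mu 0(6)])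
  qed
  moreover have "is_automorphism mu (mat 1)"
    unfolding is_automorphism_def invertible_def by (auto intro: exI[of _ "mat 1"])
  ultimately show ?case by (auto intro: exI[of _ "mat 1"])
next
  case (Suc j)
  let ?n = "trace_radical mu"
  have A0: "A \<in> flag_shift ?n 0"
    by (rule flag_shift_normalizer) (rule trace_radical_ideal(1)[OF mu A(1)])
  have n1: "B \<in> flag_shift ?n 1" if "B \<in> ?n" for B using that flag_shift_subset by blast
  have sh_le: "B \<in> flag_shift ?n i" if "B \<in> flag_shift ?n l" "i \<le> l" for B i l
    using that flag_shift_antimono by blast
  note sh_add = subspace_add[OF subspace_flag_shift] and sh_diff = subspace_diff[OF subspace_flag_shift]
  \<comment> \<open>\<open>ad A\<close> preserves this subspace because \<open>A\<close> has degree
    0; splitting inside it keeps \<open>Y\<close> in the radical and of degree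
    \<open>k\<close>.\<close>
  let ?W = "?n \<inter> flag_shift ?n k"
  have W: "subspace ?W" by (intro subspace_inter subspace_trace_radical mu subspace_flag_shift)
  have ad_k: "A ** B - B ** A \<in> flag_shift ?n i" if "B \<in> flag_shift ?n i" for B i
    using flag_shift_mult[OF A0 that] flag_shift_mult[OF that A0] by (auto intro: sh_diff)
  have "(\<lambda>B. A ** B - B ** A) ` ?W \<subseteq> ?W"
    using ad_k trace_radical_ideal(1)[OF mu A(1)] by auto
  then obtain Y where Y: "Y \<in> ?W" and comm: "A ** (X - (A ** Y - Y ** A)) - (X - (A ** Y - Y ** A)) ** A = 0"
    using kernel_plus_image[OF linear_ad W _ semisimple_ad[OF A(2)], of X] Suc.prems by blast
  define Z2 where "Z2 = X - (A ** Y - Y ** A)"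
  have Z2: "A ** Z2 = Z2 ** A" using comm unfolding Z2_def[symmetric] by simp
  have Z2n: "Z2 \<in> ?n"
    unfolding Z2_def
    by (rule subspace_diff[OF subspace_trace_radical[OF mu] \<open>X \<in> ?n\<close> trace_radical_ideal(1)[OF mu A(1)]])
      (use Y in blast)
  obtain M0 where M0: "\<And>v. ((*v) Y ^^ M0) v = 0"
    using trace_radical_nilpotent[OF mu, of Y] Y by (auto simp: nilpotent_def)
  \<comment> \<open>The \<open>2\<close> keeps the constant and linear terms in the truncated
    exponential, whatever \<open>M0\<close> is.\<close>
  define M where "M = M0 + 2"
  have M: "((*v) Y ^^ M) v = 0" for v
    unfolding M_def add.commute[of M0] funpow_add
    by (simp add: M0 linear_0[OF linear_matrix_vector_funpow])
  define g where "g = mexp M Y"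
  define w where "w = g - mat 1 - Y"
  have w: "w \<in> flag_shift ?n (Suc k)"
    unfolding w_def g_def using Y Suc.prems by (intro mexp_flag_shift) (auto simp: M_def)
  define u where "u = Y + w"
  have u: "u \<in> flag_shift ?n k"
    unfolding u_def using Y w sh_le[OF w, of k] by (intro sh_add) auto
  have gu: "g = mat 1 + u" by (simp add: u_def w_def)
  obtain e where e: "e \<in> flag_shift ?n k" and gh: "g ** (mat 1 + e) = mat 1" "(mat 1 + e) ** g = mat 1"
    using flag_unipotent_inverse[OF N u \<open>1 \<le> k\<close>] unfolding gu by blast
  define h where "h = mat 1 + e"
  note gh = gh[folded h_def]
  have Yd: "is_derivation mu Y" using Y by (simp add: trace_radical_def)
  have g: "is_automorphism mu g"
    using mexp_multiplicative[OF mu Yd M] gh unfolding is_automorphism_def invertible_def g_def by blast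
  have h: "is_automorphism mu h" by (rule automorphism_inverse[OF g gh])
  define A'' where "A'' = g ** A' ** h"
  have A''d: "is_derivation mu A''"
    unfolding A''_def by (rule is_derivation_conjugate[OF g gh \<open>is_derivation mu A'\<close> mu])
  have A''s: "semisimple A''"
  proof -
    obtain P :: "complex^'a^'a" and d where P: "invertible P" and "A' = P ** diag d ** matrix_inv P"
      using \<open>semisimple A'\<close> unfolding semisimple_def by blast
    then have "A'' = (g ** P) ** diag d ** (matrix_inv P ** h)" unfolding A''_def by (simp add: matrix_mul_assoc)
    moreover have "matrix_inv (g ** P) = matrix_inv P ** h"
    proof (rule matrix_inv_eqI)
      have "g ** P ** (matrix_inv P ** h) = g ** (P ** matrix_inv P) ** h" by (simp only: matrix_mul_assoc)
      then show "g ** P ** (matrix_inv P ** h) = mat 1" using gh by (simp add: matrix_inv_right[OF P])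
      have "matrix_inv P ** h ** (g ** P) = matrix_inv P ** (h ** g) ** P" by (simp only: matrix_mul_assoc)
      then show "matrix_inv P ** h ** (g ** P) = mat 1" using gh by (simp add: matrix_inv_left[OF P])
    qed
    moreover have "invertible (g ** P)" using g P by (simp add: is_automorphism_def invertible_mult)
    ultimately show ?thesis unfolding semisimple_def by metis
  qed
  have A''t: "trace (A'' ** B) = trace B" if "is_derivation mu B" for B
  proof -
    have "trace (A'' ** B) = trace (g ** (A' ** h ** B))" unfolding A''_def by (simp add: matrix_mul_assoc)
    also have "\<dots> = trace (A' ** (h ** B ** g))"
      by (subst trace_mul_sym) (simp add: matrix_mul_assoc)
    also have "\<dots> = trace (h ** B ** g)"
      by (intro \<open>\<And>B. is_derivation mu B \<Longrightarrow> trace (A' ** B) = trace B\<close>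
          is_derivation_conjugate[OF h gh(2,1) that mu])
    also have "\<dots> = trace B"
      using trace_mul_sym[of "h ** B" g] gh by (simp add: matrix_mul_assoc)
    finally show ?thesis .
  qed
  \<comment> \<open>Expand \<open>g A' - A g\<close> with \<open>g = 1 + Y + w\<close>:
    \<open>X + [Y, A]\<close> is \<open>Z2\<close>, and \<open>a\<close> collects the rest. Its
    degree is \<open>k + 1\<close>, since \<open>w\<close> has that degree, \<open>u\<close> has
    degree \<open>k\<close> and \<open>Z + X\<close> has degree 1.\<close>
  define a where "a = (w ** A - A ** w) + u ** (Z + X)"
  define Q where "Q = (Z + Z2) + a"
  have wA: "w ** A - A ** w \<in> flag_shift ?n (Suc k)"
    using subspace_neg[OF subspace_flag_shift ad_k[OF w]] by simp
  have a: "a \<in> flag_shift ?n (Suc k)"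
    unfolding a_def
    using sh_add[OF wA] flag_shift_mult[OF u sh_add[OF n1 n1], of Z X] Suc.prems by auto
  have Q: "Q \<in> flag_shift ?n 1"
    unfolding Q_def
    by (rule sh_add[OF sh_add[OF n1[OF \<open>Z \<in> ?n\<close>] n1[OF Z2n]] sh_le[OF a]]) simp
  have "g ** A' - A ** g = Q"
    unfolding Q_def a_def Z2_def gu u_def \<open>A' = A + Z + X\<close>
    by (simp add: matrix_mul_algebra)
  moreover have "A'' - A = (g ** A' - A ** g) ** h"
    unfolding A''_def matrix_mul_algebra using gh by (simp add: matrix_mul_assoc[symmetric])
  ultimately have A''A: "A'' - A = Q + Q ** e" unfolding h_def by (simp add: matrix_mul_algebra)
  define X' where "X' = A'' - A - (Z + Z2)"
  have "A'' - A \<in> ?n"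
    using A A''d A''t
    by (auto simp: trace_radical_def matrix_mul_algebra trace_sub intro!: is_derivation_diff mu)
  then have X'n: "X' \<in> ?n"
    unfolding X'_def using subspace_trace_radical[OF mu]
    by (intro subspace_diff[OF _ _ subspace_add[OF _ \<open>Z \<in> ?n\<close> Z2n]])
  \<comment> \<open>\<open>Q\<close> has only degree 1, but \<open>e\<close> has degree
    \<open>k\<close>; so the new error has degree \<open>k + 1\<close>, while \<open>Z2\<close> has
    joined the commuting part.\<close>
  have "X' = a + Q ** e" unfolding X'_def A''A Q_def by simp
  then have X'k: "X' \<in> flag_shift ?n (Suc k)"
    using sh_add[OF a] flag_shift_mult[OF Q e] by simp
  have "\<exists>g'. is_automorphism mu g' \<and> A'' ** g' = g' ** A"
  proof (rule Suc.hyps(1)[of "Suc k" A'' "Z + Z2" X'])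
    show "j = N - Suc k" using Suc.hyps(2) by simp
    show "A'' = A + (Z + Z2) + X'" by (simp add: X'_def)
    show "Z + Z2 \<in> ?n" using Suc.prems(5) Z2n subspace_trace_radical[OF mu] by (intro subspace_add)
    show "A ** (Z + Z2) = (Z + Z2) ** A" using Suc.prems(6) Z2 by (simp add: matrix_mul_algebra)
  qed (use A''d A''s A''t X'n X'k in auto)
  then obtain g' where g': "is_automorphism mu g'" "A'' ** g' = g' ** A" by blast
  have "A' ** (h ** g') = (h ** g) ** A' ** (h ** g')" using gh by simp
  also have "\<dots> = h ** (A'' ** g')" unfolding A''_def by (simp only: matrix_mul_assoc)
  also have "\<dots> = (h ** g') ** A" unfolding g'(2) by (simp only: matrix_mul_assoc)
  finally show ?case using automorphism_mult[OF h g'(1)] by blast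
qed

section \<open>Conjugacy, existence and rationality\<close>

lemma real_diagonalizable_semisimple: "real_diagonalizable A \<Longrightarrow> semisimple A"
proof -
  assume "real_diagonalizable A"
  then obtain P :: "complex^'a^'a" and d :: "'a \<Rightarrow> real" where "invertible P"
    "A = P ** diag (\<lambda>i. of_real (d i)) ** matrix_inv P"
    unfolding real_diagonalizable_def diag_def by blast
  then show ?thesis unfolding semisimple_def by blast
qed

text \<open>\<open>psi - phi\<close> pairs to 0 with every derivation, so it is in the radical and
  has degree 1; the reduction starts with commuting part 0.\<close>

lemma nikolayevsky_derivation_conjugate:
  assumes mu: "cbilinear mu" and phi: "nikolayevsky_derivation mu phi" and psi: "nikolayevsky_derivation mu psi"
  shows "\<exists>g. is_automorphism mu g \<and> psi = g ** phi ** matrix_inv g"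
proof -
  obtain N where N: "flag (trace_radical mu) N \<subseteq> {0}" by (rule trace_radical_flag[OF mu])
  have d: "psi - phi \<in> trace_radical mu"
    using phi psi unfolding nikolayevsky_derivation_def trace_radical_def
    by (auto simp: matrix_mul_algebra trace_sub intro!: is_derivation_diff mu)
  have "\<exists>g. is_automorphism mu g \<and> psi ** g = g ** phi"
  proof (rule trace_representing_conjugate_aux[OF mu N, where Z = 0 and X = "psi - phi" and k = 1])
    show "psi - phi \<in> flag_shift (trace_radical mu) 1" using d flag_shift_subset by blast
  qed (use phi psi d subspace_0[OF subspace_trace_radical[OF mu]] in
      \<open>auto simp: nikolayevsky_derivation_def real_diagonalizable_semisimple\<close>)
  then obtain g where g: "is_automorphism mu g" "psi ** g = g ** phi" by blast
  then have "psi ** (g ** matrix_inv g) = g ** phi ** matrix_inv g" by (simp add: matrix_mul_assoc)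
  then show ?thesis using g(1) by (auto simp: is_automorphism_def matrix_inv_right)
qed

text \<open>Rationality already enters existence: it makes the eigenvalues of the complex semisimple
  representative real.\<close>

lemma nikolayevsky_derivation_exists:
  assumes mu: "cbilinear mu"
  shows "\<exists>phi. nikolayevsky_derivation mu phi"
proof -
  obtain P :: "complex^'a^'a" and d where P: "invertible P"
    and S: "is_derivation mu (P ** diag d ** matrix_inv P)"
    and tr: "\<And>B. is_derivation mu B \<Longrightarrow> trace ((P ** diag d ** matrix_inv P) ** B) = trace B"
    using trace_represented_by_semisimple_derivation[OF mu] by blast
  have "of_real (Re (d i)) = d i" for i
    using trace_representing_eigenvalues_rational[OF mu P S tr, of i]
    by (intro of_real_Re) (auto elim!: Rats_cases')
  then have d: "d = (\<lambda>i. of_real (Re (d i)))" by simp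
  have "real_diagonalizable (P ** diag d ** matrix_inv P)"
    unfolding real_diagonalizable_def diag_def
    using P by (subst d) (intro exI[of _ P] exI[of _ "\<lambda>i. Re (d i)"] conjI refl)
  then show ?thesis using S tr unfolding nikolayevsky_derivation_def by blast
qed

lemma nikolayevsky_eigenvalue_rational:
  assumes mu: "cbilinear mu" and phi: "nikolayevsky_derivation mu phi" and l: "is_eigenvalue phi l"
  shows "l \<in> \<rat>"
proof -
  obtain P :: "complex^'a^'a" and d :: "'a \<Rightarrow> real" where P: "invertible P"
    and phiP: "phi = P ** diag (\<lambda>i. of_real (d i)) ** matrix_inv P"
    using phi unfolding nikolayevsky_derivation_def real_diagonalizable_def diag_def by blast
  have rat: "of_real (d i) \<in> (\<rat> :: complex set)" for i
    using trace_representing_eigenvalues_rational[OF mu P, of "\<lambda>i. of_real (d i)" i] phi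
    unfolding nikolayevsky_derivation_def phiP by blast
  obtain v where v: "v \<noteq> 0" "phi *v v = l *s v" using l unfolding is_eigenvalue_def by blast
  let ?c = "matrix_inv P *v v"
  have "matrix_inv P *v (phi *v v) = l *s ?c" unfolding v(2) by (simp add: matrix_vector_mult_smult)
  then have c: "diag (\<lambda>i. of_real (d i)) *v ?c = l *s ?c"
    unfolding phiP by (simp add: matrix_vector_inv_left[OF P] flip: matrix_vector_mul_assoc)
  have "?c \<noteq> 0" using v(1) matrix_vector_inv_right[OF P, of v] by auto
  then obtain i where i: "?c $ i \<noteq> 0" by (auto simp: vec_eq_iff)
  have "of_real (d i) * ?c $ i = l * ?c $ i"
    using arg_cong[OF c, of "\<lambda>x. x $ i"] by (simp add: diag_vector)
  then have "l = of_real (d i)" using i by simp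
  then show ?thesis using rat by simp
qed

theorem theorem4p1:
  fixes mu :: "complex^'n \<Rightarrow> complex^'n \<Rightarrow> complex^'n"
  assumes "cbilinear mu"
  shows "(\<exists>phi. nikolayevsky_derivation mu phi)
    \<and> (\<forall>phi psi. nikolayevsky_derivation mu phi \<and> nikolayevsky_derivation mu psi \<longrightarrow>
          (\<exists>g. is_automorphism mu g \<and> psi = g ** phi ** matrix_inv g))
    \<and> (\<forall>phi l. nikolayevsky_derivation mu phi \<and> is_eigenvalue phi l \<longrightarrow> l \<in> \<rat>)
    \<and> (\<forall>(c::real) D. (\<exists>x y. mu x y \<noteq> 0) \<and> is_derivation mu D \<and>
          M_mat mu = mat (complex_of_real c) + D \<longrightarrow>
          nikolayevsky_derivation mu (mat (complex_of_real (- 1 / c)) ** D))"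
  using nikolayevsky_derivation_exists[OF assms] nikolayevsky_derivation_conjugate[OF assms]
    nikolayevsky_eigenvalue_rational[OF assms] critical_point_nikolayevsky[OF assms]
  by blast

end
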